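(* There exists an absolute constant $C$ such that for all positive integers $m,n$, $$\mathcal{E}_{2,1}\big(\mathrm{id}:\ \ell_\infty^n\mathbin{\widehat\otimes}\ell_2^m\to\ell_\infty^n\mathbin{\check\otimes}\ell_2^m\big)\le C\sqrt{1+n+m}\,(1+\ln n)^{3/2}.$$
   Context: For finite-dimensional Banach spaces $X,Y$ with unit balls $B_X,B_Y$: $X\mathbin{\check\otimes}Y$ is $X\otimes Y$ with the injective norm $\|T\|_\vee=\sup_{x^*\in B_{X^*},y^*\in B_{Y^*}}|\langle x^*\otimes y^*,T\rangle|$ (the operator norm of $T$ as a map $X^*\to Y$), and $X\mathbin{\widehat\otimes}Y$ is $X\otimes Y$ with the projective norm $\|T\|_\wedge=\inf\{\sum_{k}\|x_k\|_X\|y_k\|_Y:\ T=\sum_{k} x_k\otimes y_k\}$ (finite sums). For symmetric convex bodies $D,E$ the packing number is $M(D,E)=\max\{l:\exists\,y_1,\dots,y_l\in D,\ y_j-y_k\notin E\ \forall j\ne k\}$. For a linear operator $T:X\to Y$ the dyadic entropy numbers are $e_k(T)=\inf\{\epsilon>0: M(T(B_X),\epsilon B_Y)\le2^{k-1}\}$, and $\mathcal{E}_{2,1}(T)=\sum_{k=1}^\infty e_k(T)/\sqrt k$. *)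

theory Defs
  imports "HOL-Analysis.Analysis" "HOL-Analysis.Finite_Function_Topology" "HOL-Library.Extended_Nat"
begin

text \<open>
  The dimensions are quantified inside the statement, so finite-dimensional real spaces are taken
  as subspaces of the free vector spaces \<open>'i \<Rightarrow>\<^sub>0 real\<close> (finitely supported families), with the
  norm given explicitly. The norm that the library puts on \<open>'i \<Rightarrow>\<^sub>0 real\<close> is never used; only its
  vector space structure is.
\<close>

record 'a nspace =
  pts :: "'a set"
  nrm :: "'a \<Rightarrow> real"

definition unit_ball :: "'a nspace \<Rightarrow> 'a set" where
  "unit_ball X = {x \<in> pts X. nrm X x \<le> 1}"

definition linf_space :: "nat \<Rightarrow> (nat \<Rightarrow>\<^sub>0 real) nspace" where
  "linf_space n = \<lparr> pts = {x. Poly_Mapping.keys x \<subseteq> {..<n}},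
                    nrm = (\<lambda>x. Max ((\<lambda>i. \<bar>Poly_Mapping.lookup x i\<bar>) ` {..<n})) \<rparr>"

definition l2_space :: "nat \<Rightarrow> (nat \<Rightarrow>\<^sub>0 real) nspace" where
  "l2_space m = \<lparr> pts = {x. Poly_Mapping.keys x \<subseteq> {..<m}},
                  nrm = (\<lambda>x. L2_set (Poly_Mapping.lookup x) {..<m}) \<rparr>"

text \<open>
  Tensor products are formed inside \<open>('i \<times> 'j) \<Rightarrow>\<^sub>0 real\<close>, the tensor product of the free spaces
  over \<open>'i\<close> and \<open>'j\<close>.
\<close>

lift_definition tensor :: "('i \<Rightarrow>\<^sub>0 real) \<Rightarrow> ('j \<Rightarrow>\<^sub>0 real) \<Rightarrow> ('i \<times> 'j \<Rightarrow>\<^sub>0 real)"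
  is "\<lambda>x y (i, j). x i * y j"
  subgoal for x y
    by (rule finite_subset[of _ "{i. x i \<noteq> 0} \<times> {j. y j \<noteq> 0}"]) auto
  done

definition tensor_pts :: "('i \<Rightarrow>\<^sub>0 real) nspace \<Rightarrow> ('j \<Rightarrow>\<^sub>0 real) nspace \<Rightarrow> ('i \<times> 'j \<Rightarrow>\<^sub>0 real) set" where
  "tensor_pts X Y = span {tensor x y | x y. x \<in> pts X \<and> y \<in> pts Y}"

text \<open>
  A functional on \<open>pts X\<close> is represented by any of its linear extensions to the ambient free space;
  the condition and the pairing with elements of \<open>X \<otimes> Y\<close> depend only on the restriction.
\<close>

definition dual_ball :: "'a::real_vector nspace \<Rightarrow> ('a \<Rightarrow> real) set" where
  "dual_ball X = {f. linear f \<and> (\<forall>x\<in>unit_ball X. \<bar>f x\<bar> \<le> 1)}"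

definition tensor_pairing ::
    "(('i \<Rightarrow>\<^sub>0 real) \<Rightarrow> real) \<Rightarrow> (('j \<Rightarrow>\<^sub>0 real) \<Rightarrow> real) \<Rightarrow> ('i \<times> 'j \<Rightarrow>\<^sub>0 real) \<Rightarrow> real" where
  "tensor_pairing f g T =
     (\<Sum>(i, j)\<in>Poly_Mapping.keys T. Poly_Mapping.lookup T (i, j) *
        f (Poly_Mapping.single i 1) * g (Poly_Mapping.single j 1))"

lemma lookup_scaleR:
  fixes x :: "'i \<Rightarrow>\<^sub>0 real"
  shows "Poly_Mapping.lookup (c *\<^sub>R x) i = c * Poly_Mapping.lookup x i"
proof -
  have "finite {i. c *\<^sub>R Poly_Mapping.lookup x i \<noteq> 0}"
    by (rule finite_subset[OF _ finite_lookup[of x]]) auto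
  then show ?thesis
    by (simp add: scaleR_poly_mapping_def Abs_poly_mapping_inverse)
qed

lemma linear_eq_sum_single:
  fixes f :: "('i \<Rightarrow>\<^sub>0 real) \<Rightarrow> real"
  assumes "linear f"
  shows "f x = (\<Sum>i\<in>Poly_Mapping.keys x. Poly_Mapping.lookup x i * f (Poly_Mapping.single i 1))"
proof -
  have s: "Poly_Mapping.single i c = c *\<^sub>R Poly_Mapping.single i (1::real)" for i :: 'i and c
    by (rule poly_mapping_eqI) (simp add: lookup_single lookup_scaleR when_def)
  have "x = (\<Sum>i\<in>Poly_Mapping.keys x. Poly_Mapping.single i (Poly_Mapping.lookup x i))"
    by (rule poly_mapping_eqI) (simp add: lookup_sum lookup_single when_def in_keys_iff sum.delta)
  also have "\<dots> = (\<Sum>i\<in>Poly_Mapping.keys x. Poly_Mapping.lookup x i *\<^sub>R Poly_Mapping.single i 1)"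
    by (metis s)
  finally have "f x = f (\<Sum>i\<in>Poly_Mapping.keys x. Poly_Mapping.lookup x i *\<^sub>R Poly_Mapping.single i 1)"
    by simp
  then show ?thesis
    by (simp add: linear_sum[OF assms] linear_cmul[OF assms])
qed

lemma tensor_pairing_tensor:
  assumes "linear f" "linear g"
  shows "tensor_pairing f g (tensor x y) = f x * g y"
proof -
  have k: "Poly_Mapping.keys (tensor x y) = Poly_Mapping.keys x \<times> Poly_Mapping.keys y"
    by (auto simp: in_keys_iff tensor.rep_eq)
  show ?thesis
    unfolding tensor_pairing_def k linear_eq_sum_single[OF assms(1), of x]
      linear_eq_sum_single[OF assms(2), of y] sum_product sum.cartesian_product
    by (intro sum.cong) (auto simp: tensor.rep_eq)
qed

definition injective_tensor ::
    "('i \<Rightarrow>\<^sub>0 real) nspace \<Rightarrow> ('j \<Rightarrow>\<^sub>0 real) nspace \<Rightarrow> ('i \<times> 'j \<Rightarrow>\<^sub>0 real) nspace" where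
  "injective_tensor X Y =
     \<lparr> pts = tensor_pts X Y,
       nrm = (\<lambda>T. Sup {\<bar>tensor_pairing f g T\<bar> | f g. f \<in> dual_ball X \<and> g \<in> dual_ball Y}) \<rparr>"

definition projective_tensor ::
    "('i \<Rightarrow>\<^sub>0 real) nspace \<Rightarrow> ('j \<Rightarrow>\<^sub>0 real) nspace \<Rightarrow> ('i \<times> 'j \<Rightarrow>\<^sub>0 real) nspace" where
  "projective_tensor X Y =
     \<lparr> pts = tensor_pts X Y,
       nrm = (\<lambda>T. Inf {\<Sum>k<l. nrm X (x k) * nrm Y (y k) | (l::nat) x y.
                   (\<forall>k<l. x k \<in> pts X \<and> y k \<in> pts Y) \<and> T = (\<Sum>k<l. tensor (x k) (y k))}) \<rparr>"

text \<open>
  The supremum in \<^typ>\<open>enat\<close> is the maximum when the admissible \<open>l\<close> are bounded, and infinite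
  otherwise.
\<close>

definition packing_number :: "'a::real_vector set \<Rightarrow> 'a set \<Rightarrow> enat" where
  "packing_number D E =
     Sup {enat l | l. \<exists>y :: nat \<Rightarrow> 'a. (\<forall>j<l. y j \<in> D) \<and> (\<forall>j<l. \<forall>k<l. j \<noteq> k \<longrightarrow> y j - y k \<notin> E)}"

text \<open>Entropy numbers are meant for \<open>k \<ge> 1\<close>.\<close>

definition entropy_number ::
    "'a nspace \<Rightarrow> 'b::real_vector nspace \<Rightarrow> ('a \<Rightarrow> 'b) \<Rightarrow> nat \<Rightarrow> ennreal" where
  "entropy_number X Y T k =
     Inf {ennreal \<epsilon> | \<epsilon>. 0 < \<epsilon> \<and>
       packing_number (T ` unit_ball X) ((\<lambda>y. \<epsilon> *\<^sub>R y) ` unit_ball Y) \<le> enat (2 ^ (k - 1))}"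

definition entropy_sum_2_1 ::
    "'a nspace \<Rightarrow> 'b::real_vector nspace \<Rightarrow> ('a \<Rightarrow> 'b) \<Rightarrow> ennreal" where
  "entropy_sum_2_1 X Y T =
     suminf (\<lambda>k. entropy_number X Y T (Suc k) / ennreal (sqrt (real (Suc k))))"

end

theory Submission
  imports Defs
begin

text \<open>
  In coordinates a tensor is an \<open>n \<times> m\<close> matrix, and the injective norm is at most the largest
  Euclidean norm of a row (\<open>injective_norm_le\<close>). Two facts about the unit ball \<open>K\<close> of the
  projective norm give the bound. Write \<open>d = n + m\<close> and \<open>L = 1 + ln n\<close>.

  First, \<open>K\<close> lies in the convex hull of only \<open>exp (O(d))\<close> matrices with rows of norm at most \<open>2\<close>:
  the extreme points of the unit ball of \<open>\<ell>\<^sub>\<infinity>\<close> are the sign vectors, and the Euclidean unit ball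
  lies in the convex hull of at most \<open>12 ^ m\<close> scaled integer vectors
  (\<open>lattice_vectors_norming\<close>, \<open>projective_ball_atoms\<close>). Convex hulls enter only through the dual
  statement that a linear functional takes on some atom a value not above its value at the point.

  Second, Maurey's empirical method: a point of such a hull is within \<open>O(sqrt (L / N))\<close> of an
  average of \<open>N\<close> atoms (\<open>empirical_approximation\<close>). The usual random choice is replaced by a greedy
  one that keeps the potential \<open>\<Sum>i. cosh (c * \<parallel>S i\<parallel>)\<close> of the accumulated error \<open>S\<close> small. Its growth
  per step is controlled by the convexity of \<open>r \<mapsto> cosh (sqrt r)\<close>, an argument of Pinelis.

  Counting the averages covers \<open>K\<close> by \<open>2 ^ O(d N)\<close> pieces of diameter \<open>O(sqrt (L / N))\<close>, so
  \<open>e\<^sub>k = O(sqrt (d L / k))\<close> for \<open>k \<ge> d\<close>. For \<open>k \<le> d\<close> the trivial bound \<open>e\<^sub>k \<le> 2\<close> contributes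
  \<open>O(sqrt d)\<close> to the sum. Between \<open>d\<close> and \<open>n d\<close> the sum is \<open>sqrt (d L)\<close> times a
  harmonic sum of size at most \<open>L\<close>, which is where the exponent \<open>3 / 2\<close> comes from. Beyond \<open>n d\<close>, halving
  the diameter costs a factor \<open>24 ^ (n m)\<close> in the number of pieces (\<open>row_covered_half\<close>) because the
  matrices form a space of dimension \<open>n m \<le> n d\<close>. So the entropy numbers decay geometrically
  there, and the tail is again \<open>O(sqrt (d L))\<close>.
\<close>

section \<open>Approximating a point of a convex hull by short averages\<close>

lemma cosh_sqrt_sums:
  fixes r :: real
  assumes "0 \<le> r"
  shows "(\<lambda>k. r ^ k / fact (2 * k)) sums cosh (sqrt r)"
proof -
  have "(\<lambda>k. (\<lambda>n. if even n then sqrt r ^ n /\<^sub>R fact n else 0) (2 * k)) sums cosh (sqrt r)"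
    by (subst sums_mono_reindex) (auto simp: strict_mono_def cosh_converges elim!: evenE)
  moreover have "sqrt r ^ (2 * k) = r ^ k" for k
    using assms by (simp add: power_mult)
  ultimately show ?thesis
    by (simp add: divide_inverse mult.commute)
qed

text \<open>
  The power series in \<open>r\<close> has nonnegative coefficients, and each monomial is convex on the
  half-line.
\<close>

lemma convex_on_cosh_sqrt: "convex_on {0::real..} (\<lambda>r. cosh (sqrt r))"
proof (rule convex_onI)
  fix t x y :: real
  assume t: "0 < t" "t < 1" and xy: "x \<in> {0..}" "y \<in> {0..}"
  have pow: "((1 - t) *\<^sub>R x + t *\<^sub>R y) ^ k \<le> (1 - t) * x ^ k + t * y ^ k" for k
  proof -
    have "convex_on {0::real..} (\<lambda>x. x ^ k)"
      by (cases "even k") (auto intro: convex_power_odd convex_on_subset[OF convex_power_even])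
    from convex_onD[OF this, of t x y] t xy show ?thesis
      by simp
  qed
  have "(\<lambda>k. ((1 - t) *\<^sub>R x + t *\<^sub>R y) ^ k / fact (2 * k)) sums cosh (sqrt ((1 - t) *\<^sub>R x + t *\<^sub>R y))"
    using t xy by (intro cosh_sqrt_sums) auto
  moreover have "(\<lambda>k. (1 - t) * (x ^ k / fact (2 * k)) + t * (y ^ k / fact (2 * k))) sums
      ((1 - t) * cosh (sqrt x) + t * cosh (sqrt y))"
    using xy by (intro sums_add sums_mult cosh_sqrt_sums) auto
  moreover have "((1 - t) *\<^sub>R x + t *\<^sub>R y) ^ k / fact (2 * k)
      \<le> (1 - t) * (x ^ k / fact (2 * k)) + t * (y ^ k / fact (2 * k))" for k
  proof -
    have "((1 - t) *\<^sub>R x + t *\<^sub>R y) ^ k / fact (2 * k)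
        \<le> ((1 - t) * x ^ k + t * y ^ k) / fact (2 * k)"
      by (rule divide_right_mono[OF pow]) simp
    then show ?thesis
      by (simp add: add_divide_distrib)
  qed
  ultimately show "cosh (sqrt ((1 - t) *\<^sub>R x + t *\<^sub>R y)) \<le> (1 - t) * cosh (sqrt x) + t * cosh (sqrt y)"
    by (rule sums_le[rotated 1]) 
qed simp

lemma cosh_le_exp_half_square: "cosh x \<le> exp (x\<^sup>2 / 2)" for x :: real
proof -
  have "2 ^ k * fact k \<le> (fact (2 * k) :: real)" for k
  proof (induction k)
    case (Suc k)
    have "2 ^ Suc k * fact (Suc k) = 2 * real (Suc k) * (2 ^ k * fact k)"
      by simp
    also have "\<dots> \<le> (2 * real (Suc k)) * fact (2 * k)"
      by (intro mult_left_mono Suc.IH) simp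
    also have "\<dots> \<le> (2 * real (Suc k)) * (real (2 * k + 1) * fact (2 * k))"
      by (intro mult_left_mono) (auto simp: mult_le_cancel_right1)
    also have "\<dots> = fact (2 * Suc k)"
      by (simp add: algebra_simps)
    finally show ?case .
  qed simp
  then have le: "(x\<^sup>2) ^ k / fact (2 * k) \<le> (x\<^sup>2 / 2) ^ k /\<^sub>R fact k" for k
  proof -
    have "(x\<^sup>2) ^ k / fact (2 * k) \<le> (x\<^sup>2) ^ k / (2 ^ k * fact k)"
      by (rule divide_left_mono[OF \<open>2 ^ k * fact k \<le> fact (2 * k)\<close>]) auto
    also have "\<dots> = (x\<^sup>2 / 2) ^ k /\<^sub>R fact k"
      unfolding power_divide by (simp add: divide_inverse)
    finally show ?thesis .
  qed
  have "cosh (sqrt (x\<^sup>2)) \<le> exp (x\<^sup>2 / 2)"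
    by (rule sums_le[OF le cosh_sqrt_sums exp_converges]) simp
  then show ?thesis
    by simp
qed

text \<open>
  Here \<open>s\<close> is the norm of a vector, \<open>x\<close> twice its inner product with an increment and \<open>q\<close> the
  squared norm of the increment. By convexity of \<open>r \<mapsto> cosh (sqrt r)\<close> the left-hand side is below the
  chord between the extreme cases \<open>q = b\<^sup>2\<close> and \<open>x = \<plusminus> 2 * s * b\<close>, where it equals \<open>cosh (s \<plusminus> b)\<close>.
  The point is that the chord is affine in \<open>x\<close>, so its linear part vanishes on average over centred increments and
  leaves \<open>cosh s * cosh b\<close>. If \<open>s * b = 0\<close>, then \<open>x = 0\<close>, which makes the division by zero harmless.
\<close>

lemma cosh_sqrt_le_chord:
  fixes s b x q :: real
  assumes "0 \<le> s" "0 \<le> b" "\<bar>x\<bar> \<le> 2 * s * b" "q \<le> b\<^sup>2" "0 \<le> s\<^sup>2 + x + q"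
  shows "cosh (sqrt (s\<^sup>2 + x + q)) \<le> cosh s * cosh b + x * (sinh s * sinh b / (2 * s * b))"
proof -
  have "cosh (sqrt (s\<^sup>2 + x + q)) \<le> cosh (sqrt (s\<^sup>2 + x + b\<^sup>2))"
    using assms by (subst cosh_real_nonneg_le_iff) auto
  also have "\<dots> \<le> cosh s * cosh b + x * (sinh s * sinh b / (2 * s * b))"
  proof (cases "s = 0 \<or> b = 0")
    case True
    then show ?thesis
      using assms by auto
  next
    case False
    then have pos: "0 < s * b"
      using assms by auto
    define t where "t = (1 + x / (2 * s * b)) / 2"
    have "\<bar>x / (2 * s * b)\<bar> \<le> 1"
      using pos assms(3) by (subst abs_divide, subst divide_le_eq_1_pos) auto
    then have t: "0 \<le> t" "t \<le> 1"
      by (auto simp: t_def abs_if split: if_splits)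
    \<comment> \<open>the position of \<open>x\<close> between the two extreme cases\<close>
    have "s\<^sup>2 + x + b\<^sup>2 = (1 - t) *\<^sub>R (s - b)\<^sup>2 + t *\<^sub>R (s + b)\<^sup>2"
      using False by (simp add: t_def field_simps power2_eq_square)
    then have "cosh (sqrt (s\<^sup>2 + x + b\<^sup>2)) \<le> (1 - t) * cosh (sqrt ((s - b)\<^sup>2)) + t * cosh (sqrt ((s + b)\<^sup>2))"
      using convex_onD[OF convex_on_cosh_sqrt, of t "(s - b)\<^sup>2" "(s + b)\<^sup>2"] t by simp
    also have "\<dots> = (1 - t) * cosh (s - b) + t * cosh (s + b)"
      by simp
    also have "\<dots> = cosh s * cosh b + (2 * t - 1) * (sinh s * sinh b)"
      by (simp add: cosh_add cosh_diff algebra_simps)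
    also have "\<dots> = cosh s * cosh b + x * (sinh s * sinh b / (2 * s * b))"
      using False by (simp add: t_def field_simps)
    finally show ?thesis .
  qed
  finally show ?thesis .
qed

lemma L2_set_add_square:
  "(L2_set (\<lambda>j. f j + g j) J)\<^sup>2 = (L2_set f J)\<^sup>2 + 2 * (\<Sum>j\<in>J. f j * g j) + (L2_set g J)\<^sup>2"
proof -
  have sq: "(L2_set h J)\<^sup>2 = (\<Sum>j\<in>J. (h j)\<^sup>2)" for h :: "'a \<Rightarrow> real"
    by (simp add: L2_set_def sum_nonneg)
  show ?thesis
    unfolding sq sum_distrib_left sum.distrib[symmetric] by (intro sum.cong) (auto simp: power2_sum)
qed

lemma abs_sum_mult_le_L2_set: "\<bar>\<Sum>j\<in>J. f j * g j\<bar> \<le> L2_set f J * L2_set g J"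
  by (rule order_trans[OF sum_abs]) (simp add: abs_mult L2_set_mult_ineq)

text \<open>
  One step of the greedy choice, for a single row \<open>f\<close> of the accumulated error and an increment \<open>g\<close>.
  The factor after the inner product depends on \<open>f\<close> but not on \<open>g\<close>.
\<close>

lemma cosh_L2_set_add_le:
  assumes "0 \<le> c" "0 \<le> b" "L2_set g J \<le> b"
  shows "cosh (c * L2_set (\<lambda>j. f j + g j) J) \<le> cosh (c * L2_set f J) * cosh (c * b) +
    (\<Sum>j\<in>J. f j * g j) * (sinh (c * L2_set f J) * sinh (c * b) / (L2_set f J * b))"
proof (cases "c = 0")
  case False
  define ip where "ip = (\<Sum>j\<in>J. f j * g j)"
  have "\<bar>ip\<bar> \<le> L2_set f J * b"
    unfolding ip_def using assms 
    by (intro order_trans[OF abs_sum_mult_le_L2_set] mult_left_mono) auto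
  then have "c\<^sup>2 * \<bar>ip\<bar> \<le> c\<^sup>2 * (L2_set f J * b)"
    by (intro mult_left_mono) auto
  then have x: "\<bar>2 * c\<^sup>2 * ip\<bar> \<le> 2 * (c * L2_set f J) * (c * b)"
    by (simp add: abs_mult power2_eq_square mult_ac)
  have q: "(c * L2_set g J)\<^sup>2 \<le> (c * b)\<^sup>2"
    using assms by (intro power_mono mult_left_mono) auto
  have eq: "(c * L2_set (\<lambda>j. f j + g j) J)\<^sup>2 = (c * L2_set f J)\<^sup>2 + 2 * c\<^sup>2 * ip + (c * L2_set g J)\<^sup>2"
    by (simp add: power_mult_distrib L2_set_add_square ip_def algebra_simps)
  have "cosh (c * L2_set (\<lambda>j. f j + g j) J) = cosh (sqrt ((c * L2_set (\<lambda>j. f j + g j) J)\<^sup>2))"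
    by simp
  also have "\<dots> \<le> cosh (c * L2_set f J) * cosh (c * b) +
      2 * c\<^sup>2 * ip * (sinh (c * L2_set f J) * sinh (c * b) / (2 * (c * L2_set f J) * (c * b)))"
    unfolding eq using assms x q
    by (intro cosh_sqrt_le_chord) (auto simp flip: eq)
  also have "2 * c\<^sup>2 * ip * (sinh (c * L2_set f J) * sinh (c * b) / (2 * (c * L2_set f J) * (c * b)))
      = ip * (sinh (c * L2_set f J) * sinh (c * b) / (L2_set f J * b))"
    using False by (simp add: power2_eq_square)
  finally show ?thesis
    by (simp add: ip_def)
qed simp

text \<open>
  The hypothesis \<open>hull\<close> says that \<open>T\<close> is in the convex hull of \<open>F\<close>, in the dual form that
  the greedy choice uses: at each step, the part of \<open>cosh_L2_set_add_le\<close> that is linear in the new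
  point \<open>z\<close> can be made nonpositive after centring at \<open>T\<close>.
\<close>

lemma greedy_sample:
  fixes T :: "'i \<Rightarrow> 'j \<Rightarrow> real" and F :: "('i \<Rightarrow> 'j \<Rightarrow> real) set"
  assumes bnd: "\<And>z i. z \<in> F \<Longrightarrow> i \<in> I \<Longrightarrow> L2_set (\<lambda>j. z i j - T i j) J \<le> b"
    and hull: "\<And>A. \<exists>z\<in>F. (\<Sum>i\<in>I. \<Sum>j\<in>J. A i j * z i j) \<le> (\<Sum>i\<in>I. \<Sum>j\<in>J. A i j * T i j)"
    and "0 \<le> c" "0 \<le> b"
  shows "\<exists>z. (\<forall>k<N. z k \<in> F) \<and>
    (\<Sum>i\<in>I. cosh (c * L2_set (\<lambda>j. \<Sum>k<N. z k i j - T i j) J)) \<le> real (card I) * cosh (c * b) ^ N"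
proof (induction N)
  case 0
  show ?case
    by (simp add: L2_set_def)
next
  case (Suc N)
  then obtain z where z: "\<And>k. k < N \<Longrightarrow> z k \<in> F"
    and le: "(\<Sum>i\<in>I. cosh (c * L2_set (\<lambda>j. \<Sum>k<N. z k i j - T i j) J)) \<le> real (card I) * cosh (c * b) ^ N"
    by auto
  define S where "S = (\<lambda>i j. \<Sum>k<N. z k i j - T i j)"
  define r where "r = (\<lambda>i. sinh (c * L2_set (S i) J) * sinh (c * b) / (L2_set (S i) J * b))"
  obtain w where w: "w \<in> F"
    and hw: "(\<Sum>i\<in>I. \<Sum>j\<in>J. r i * S i j * w i j) \<le> (\<Sum>i\<in>I. \<Sum>j\<in>J. r i * S i j * T i j)"
    using hull[of "\<lambda>i j. r i * S i j"] by auto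
  have step: "cosh (c * L2_set (\<lambda>j. S i j + (w i j - T i j)) J) \<le> 
      cosh (c * L2_set (S i) J) * cosh (c * b) + (\<Sum>j\<in>J. S i j * (w i j - T i j)) * r i" if "i \<in> I" for i
    unfolding r_def using bnd[OF w that] assms(3,4) by (intro cosh_L2_set_add_le)
  have "(\<Sum>i\<in>I. cosh (c * L2_set (\<lambda>j. S i j + (w i j - T i j)) J)) \<le>
      (\<Sum>i\<in>I. cosh (c * L2_set (S i) J) * cosh (c * b) + (\<Sum>j\<in>J. S i j * (w i j - T i j)) * r i)"
    by (rule sum_mono[OF step])
  also have "\<dots> = (\<Sum>i\<in>I. cosh (c * L2_set (S i) J)) * cosh (c * b) +
      ((\<Sum>i\<in>I. \<Sum>j\<in>J. r i * S i j * w i j) - (\<Sum>i\<in>I. \<Sum>j\<in>J. r i * S i j * T i j))"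
    by (simp add: sum.distrib sum_distrib_left sum_distrib_right sum_subtractf algebra_simps)
  also have "\<dots> \<le> (real (card I) * cosh (c * b) ^ N) * cosh (c * b)"
    using hw mult_right_mono[OF le, of "cosh (c * b)"] unfolding S_def
    by (smt (verit) cosh_real_nonneg)
  finally have "(\<Sum>i\<in>I. cosh (c * L2_set (\<lambda>j. S i j + (w i j - T i j)) J)) \<le> real (card I) * cosh (c * b) ^ Suc N"
    by (simp add: mult_ac)
  then show ?case
    using z w by (intro exI[of _ "z(N := w)"]) (auto simp: S_def less_Suc_eq)
qed

text \<open>
  A deterministic form of Maurey's lemma in \<open>\<ell>\<^sub>\<infinity>(\<ell>\<^sub>2)\<close>. Each row is bounded through its single term in
  the potential, which costs the logarithm of the number of rows.
\<close>

lemma empirical_approximation: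
  fixes T :: "'i \<Rightarrow> 'j \<Rightarrow> real" and F :: "('i \<Rightarrow> 'j \<Rightarrow> real) set"
  assumes "finite I"
    and bnd: "\<And>z i. z \<in> F \<Longrightarrow> i \<in> I \<Longrightarrow> L2_set (\<lambda>j. z i j - T i j) J \<le> b"
    and hull: "\<And>A. \<exists>z\<in>F. (\<Sum>i\<in>I. \<Sum>j\<in>J. A i j * z i j) \<le> (\<Sum>i\<in>I. \<Sum>j\<in>J. A i j * T i j)"
    and pos: "0 < b" "0 < N"
  shows "\<exists>z. (\<forall>k<N. z k \<in> F) \<and>
    (\<forall>i\<in>I. L2_set (\<lambda>j. (\<Sum>k<N. z k i j) / real N - T i j) J \<le> b * sqrt (2 * ln (2 * real (card I)) / real N))"
proof (cases "I = {}")
  case True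
  obtain z where "z \<in> F"
    using hull by blast
  with True show ?thesis
    by (intro exI[of _ "\<lambda>_. z"]) auto
next
  case False
  define l where "l = ln (2 * real (card I))"
  have card: "1 \<le> card I"
    using False \<open>finite I\<close> by (simp add: Suc_le_eq card_gt_0_iff)
  then have l: "0 < l"
    by (simp add: l_def)
  \<comment> \<open>makes the logarithm \<open>l\<close> equal to the growth \<open>N * (c * b)\<^sup>2 / 2\<close> of the potential\<close>
  define c where "c = sqrt (2 * l / real N) / b"
  have c: "0 < c"
    using l pos by (simp add: c_def)
  have "\<exists>z. (\<forall>k<N. z k \<in> F) \<and>
      (\<Sum>i\<in>I. cosh (c * L2_set (\<lambda>j. \<Sum>k<N. z k i j - T i j) J)) \<le> real (card I) * cosh (c * b) ^ N"
    using c pos by (intro greedy_sample bnd hull) auto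
  then obtain z where z: "\<And>k. k < N \<Longrightarrow> z k \<in> F"
    and le: "(\<Sum>i\<in>I. cosh (c * L2_set (\<lambda>j. \<Sum>k<N. z k i j - T i j) J)) \<le> real (card I) * cosh (c * b) ^ N"
    by blast
  have "L2_set (\<lambda>j. (\<Sum>k<N. z k i j) / real N - T i j) J \<le> b * sqrt (2 * l / real N)" if "i \<in> I" for i
  proof -
    define D where "D = L2_set (\<lambda>j. \<Sum>k<N. z k i j - T i j) J"
    have "cosh (c * D) \<le> (\<Sum>i\<in>I. cosh (c * L2_set (\<lambda>j. \<Sum>k<N. z k i j - T i j) J))"
      unfolding D_def using that \<open>finite I\<close>
      by (intro member_le_sum[where f = "\<lambda>i. cosh (c * L2_set (\<lambda>j. \<Sum>k<N. z k i j - T i j) J)"]) auto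
    also have "\<dots> \<le> real (card I) * cosh (c * b) ^ N"
      by (rule le)
    also have "\<dots> \<le> real (card I) * exp ((c * b)\<^sup>2 / 2) ^ N"
      by (intro mult_left_mono power_mono cosh_le_exp_half_square) auto
    finally have "2 * cosh (c * D) \<le> 2 * real (card I) * exp ((c * b)\<^sup>2 / 2) ^ N"
      by simp
    moreover have "2 * real (card I) = exp l"
      using card by (simp add: l_def)
    moreover have "exp ((c * b)\<^sup>2 / 2) ^ N = exp (real N * ((c * b)\<^sup>2 / 2))"
      by (rule exp_of_nat_mult[symmetric])
    moreover have "real N * ((c * b)\<^sup>2 / 2) = l"
      using l pos by (simp add: c_def)
    moreover have "exp (c * D) \<le> 2 * cosh (c * D)"
      by (simp add: cosh_def)
    ultimately have "exp (c * D) \<le> exp (l + l)"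
      unfolding exp_add by simp
    then have "c * D \<le> 2 * l"
      by simp
    then have "D \<le> 2 * l / c"
      using c by (simp add: field_simps)
    also have "\<dots> = real N * (b * sqrt (2 * l / real N))"
    proof -
      define e where "e = sqrt (2 * l / real N)"
      have "real N * (e * e) = 2 * l" "0 < e"
        using l pos by (simp_all add: e_def)
      then show ?thesis
        using pos unfolding c_def e_def[symmetric] by (simp add: field_simps)
    qed
    finally have "D / real N \<le> b * sqrt (2 * l / real N)"
      using pos by (simp add: field_simps)
    moreover have "L2_set (\<lambda>j. (\<Sum>k<N. z k i j) / real N - T i j) J = L2_set (\<lambda>j. (\<Sum>k<N. z k i j - T i j) * (1 / real N)) J"
      using pos by (intro L2_set_cong) (auto simp: sum_subtractf field_simps)
    moreover have "\<dots> = D / real N"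
      unfolding D_def by (subst L2_set_left_distrib[symmetric]) auto
    ultimately show ?thesis
      by simp
  qed
  with z show ?thesis
    by (auto simp: l_def)
qed

section \<open>A small norming set for the projective unit ball\<close>

lemma sum_half_power_abs: "(\<Sum>t\<in>{- int B..int B}. (1 / 2 :: real) ^ nat \<bar>t\<bar>) \<le> 3"
proof -
  have "(\<Sum>t\<in>{- int B..int B}. (1 / 2 :: real) ^ nat \<bar>t\<bar>) = 3 - 2 * (1 / 2) ^ B"
  proof (induction B)
    case (Suc B)
    have "{- int (Suc B)..int (Suc B)} = insert (- int (Suc B)) (insert (int (Suc B)) {- int B..int B})"
      by auto
    then show ?case
      using Suc.IH by (simp add: nat_add_distrib)
  qed simp
  then show ?thesis
    by simp
qed

text \<open>
  Weighting each vector by \<open>2 ^ (- \<bar>z\<bar>)\<close>, with the \<open>\<ell>\<^sub>1\<close> norm in the exponent, makes the count a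
  product of one-dimensional sums, each at most \<open>3\<close>. This replaces a volume comparison.
\<close>

lemma card_integer_vectors_l1_le:
  fixes I :: "'i set" and R :: nat
  assumes "finite I"
  defines "S \<equiv> {z \<in> I \<rightarrow>\<^sub>E (UNIV :: int set). (\<Sum>i\<in>I. \<bar>z i\<bar>) \<le> int (R * card I)}"
  shows "finite S" "card S \<le> (3 * 2 ^ R) ^ card I"
proof -
  define B where "B = R * card I"
  define P where "P = (I \<rightarrow>\<^sub>E {- int B..int B})"
  have finP: "finite P"
    unfolding P_def using \<open>finite I\<close> by (intro finite_PiE) auto
  have SP: "S \<subseteq> P"
  proof
    fix z assume z: "z \<in> S"
    have "\<bar>z i\<bar> \<le> int B" if "i \<in> I" for i
      using z member_le_sum[OF that, of "\<lambda>i. \<bar>z i\<bar>"] \<open>finite I\<close> unfolding S_def B_def by force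
    then show "z \<in> P"
      using z by (fastforce simp: S_def P_def PiE_iff abs_le_iff)
  qed
  show "finite S"
    using finite_subset[OF SP finP] .
  define wt where "wt = (\<lambda>z::'i \<Rightarrow> int. \<Prod>i\<in>I. (1 / 2 :: real) ^ nat \<bar>z i\<bar>)"
  have wt: "1 \<le> 2 ^ B * wt z" if "z \<in> S" for z
  proof -
    have "int (\<Sum>i\<in>I. nat \<bar>z i\<bar>) \<le> int B"
      using that by (simp add: S_def B_def)
    then have "(\<Sum>i\<in>I. nat \<bar>z i\<bar>) \<le> B"
      by linarith
    then have "(1 / 2 :: real) ^ B \<le> (1 / 2) ^ (\<Sum>i\<in>I. nat \<bar>z i\<bar>)"
      by (intro power_decreasing) auto
    also have "\<dots> = wt z"
      by (simp add: wt_def power_sum)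
    finally show ?thesis
      by (simp add: power_divide field_simps)
  qed
  have "real (card S) = (\<Sum>z\<in>S. 1)"
    by simp
  also have "\<dots> \<le> (\<Sum>z\<in>S. 2 ^ B * wt z)"
    by (rule sum_mono[OF wt])
  also have "\<dots> \<le> (\<Sum>z\<in>P. 2 ^ B * wt z)"
    by (intro sum_mono2 finP SP) (auto simp: wt_def intro!: mult_nonneg_nonneg prod_nonneg)
  also have "\<dots> = 2 ^ B * (\<Prod>i\<in>I. \<Sum>t\<in>{- int B..int B}. (1 / 2) ^ nat \<bar>t\<bar>)"
    unfolding P_def wt_def sum_distrib_left[symmetric]
    using \<open>finite I\<close> by (subst prod_sum_PiE) auto
  also have "\<dots> \<le> 2 ^ B * 3 ^ card I"
  proof -
    have "(\<Prod>i\<in>I. \<Sum>t\<in>{- int B..int B}. (1 / 2 :: real) ^ nat \<bar>t\<bar>) \<le> (\<Prod>i\<in>I. 3)"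
      by (intro prod_mono conjI sum_nonneg sum_half_power_abs) auto
    then show ?thesis
      by simp
  qed
  also have "\<dots> = real ((3 * 2 ^ R) ^ card I)"
    by (simp add: B_def power_mult power_mult_distrib)
  finally show "card S \<le> (3 * 2 ^ R) ^ card I"
    by (simp only: of_nat_le_iff)
qed

text \<open>
  Divided by the square root of \<open>card J\<close>, these vectors form a set of norm at most \<open>2\<close> whose
  convex hull contains the Euclidean unit ball. The \<open>\<ell>\<^sub>1\<close> bound is there for counting.
\<close>

definition lattice_vectors :: "'j set \<Rightarrow> ('j \<Rightarrow> int) set" where
  "lattice_vectors J = {w \<in> J \<rightarrow>\<^sub>E UNIV. (\<Sum>j\<in>J. \<bar>w j\<bar>) \<le> 2 * int (card J) \<and>
     (\<Sum>j\<in>J. (w j)\<^sup>2) \<le> 4 * int (card J)}"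

text \<open>
  Rescale \<open>b\<close> to a vector \<open>u\<close> with \<open>\<parallel>u\<parallel>\<^sup>2 = m\<close> and round \<open>2 * u\<close> towards zero. Rounding loses at most
  \<open>\<Sum>\<bar>u j\<bar> \<le> m\<close> of the inner product \<open>2 * m\<close> with \<open>u\<close>, so the rounded vector still has inner product at
  least \<open>m\<close> with \<open>u\<close>.
\<close>

lemma lattice_vectors_norming:
  fixes b :: "'j \<Rightarrow> real"
  assumes "finite J" "J \<noteq> {}"
  shows "\<exists>w\<in>lattice_vectors J. L2_set b J \<le> (\<Sum>j\<in>J. real_of_int (w j) * b j) / sqrt (real (card J))"
proof (cases "L2_set b J = 0")
  case True
  then have "\<forall>j\<in>J. b j = 0"
    using assms by (simp add: L2_set_eq_0_iff)
  then show ?thesis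
    using True by (intro bexI[of _ "\<lambda>j\<in>J. 0"]) (auto simp: lattice_vectors_def)
next
  case False
  define m where "m = card J"
  have m: "0 < real m"
    using assms by (simp add: m_def card_gt_0_iff)
  define \<beta> where "\<beta> = L2_set b J"
  have \<beta>: "0 < \<beta>"
    using False L2_set_nonneg[of b J] unfolding \<beta>_def by linarith
  define u where "u = (\<lambda>j. sqrt (real m) * b j / \<beta>)"
  define w where "w = (\<lambda>j\<in>J. if 0 \<le> u j then \<lfloor>2 * u j\<rfloor> else - \<lfloor>- 2 * u j\<rfloor>)"
  have "(\<Sum>j\<in>J. (u j)\<^sup>2) = real m * (\<Sum>j\<in>J. (b j)\<^sup>2) / \<beta>\<^sup>2"
    by (simp add: u_def power_divide power_mult_distrib sum_distrib_left sum_divide_distrib)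
  also have "(\<Sum>j\<in>J. (b j)\<^sup>2) = \<beta>\<^sup>2"
    by (simp add: \<beta>_def L2_set_def sum_nonneg)
  finally have sq: "(\<Sum>j\<in>J. (u j)\<^sup>2) = real m"
    using \<beta> by simp
  then have "L2_set u J = sqrt (real m)"
    by (simp add: L2_set_def)
  then have l1: "(\<Sum>j\<in>J. \<bar>u j\<bar>) \<le> real m"
    using L2_set_mult_ineq[of u "\<lambda>_. 1" J] m by (simp add: L2_set_constant m_def)
  have w_abs: "\<bar>real_of_int (w j)\<bar> \<le> 2 * \<bar>u j\<bar>" if "j \<in> J" for j
  proof -
    have "0 \<le> \<lfloor>2 * u j\<rfloor>" if "0 \<le> u j"
      using that by simp
    moreover have "0 \<le> \<lfloor>- 2 * u j\<rfloor>" if "u j < 0"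
      using that by simp
    ultimately show ?thesis
      using that unfolding w_def by (cases "0 \<le> u j") (auto simp del: zero_le_floor)
  qed
  have w_u: "2 * (u j)\<^sup>2 - \<bar>u j\<bar> \<le> real_of_int (w j) * u j" if "j \<in> J" for j
  proof (cases "0 \<le> u j")
    case True
    have "(2 * u j - 1) * u j \<le> real_of_int (w j) * u j"
    proof (rule mult_right_mono[OF _ True])
      show "2 * u j - 1 \<le> real_of_int (w j)"
        using that True floor_correct[of "2 * u j"] by (simp add: w_def)
    qed
    then show ?thesis
      using True by (simp add: power2_eq_square algebra_simps)
  next
    case False
    have "(- 2 * u j - 1) * (- u j) \<le> real_of_int (- w j) * (- u j)"
    proof (rule mult_right_mono)
      show "- 2 * u j - 1 \<le> real_of_int (- w j)"
        using that False floor_correct[of "- 2 * u j"] by (simp add: w_def)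
    qed (use False in simp)
    then show ?thesis
      using False by (simp add: power2_eq_square algebra_simps)
  qed
  have "real_of_int (\<Sum>j\<in>J. \<bar>w j\<bar>) \<le> (\<Sum>j\<in>J. 2 * \<bar>u j\<bar>)"
    using w_abs by (simp add: sum_mono)
  also have "\<dots> \<le> 2 * real m"
    using l1 by (simp flip: sum_distrib_left)
  finally have w1: "(\<Sum>j\<in>J. \<bar>w j\<bar>) \<le> 2 * int m"
    by linarith
  have "real_of_int (\<Sum>j\<in>J. (w j)\<^sup>2) \<le> (\<Sum>j\<in>J. 4 * (u j)\<^sup>2)"
  proof -
    have "(real_of_int (w j))\<^sup>2 \<le> 4 * (u j)\<^sup>2" if "j \<in> J" for j
      using power_mono[OF w_abs[OF that], of 2] by (simp add: power_mult_distrib)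
    then show ?thesis
      by (simp add: sum_mono)
  qed
  also have "\<dots> = 4 * real m"
    using sq by (simp flip: sum_distrib_left)
  finally have w2: "(\<Sum>j\<in>J. (w j)\<^sup>2) \<le> 4 * int m"
    by linarith
  have "real m \<le> (\<Sum>j\<in>J. 2 * (u j)\<^sup>2 - \<bar>u j\<bar>)"
    using l1 sq by (simp add: sum_subtractf flip: sum_distrib_left)
  also have "\<dots> \<le> (\<Sum>j\<in>J. real_of_int (w j) * u j)"
    by (rule sum_mono[OF w_u])
  also have "\<dots> = (sqrt (real m) / \<beta>) * (\<Sum>j\<in>J. real_of_int (w j) * b j)"
    by (simp add: u_def sum_distrib_left mult_ac)
  finally have "sqrt (real m) * sqrt (real m) \<le> sqrt (real m) * ((\<Sum>j\<in>J. real_of_int (w j) * b j) / \<beta>)"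
    using m by simp
  then have "sqrt (real m) \<le> (\<Sum>j\<in>J. real_of_int (w j) * b j) / \<beta>"
    using m by (simp only: mult_le_cancel_left_pos real_sqrt_gt_0_iff)
  then have "\<beta> \<le> (\<Sum>j\<in>J. real_of_int (w j) * b j) / sqrt (real m)"
    using m \<beta> by (simp add: field_simps)
  moreover have "w \<in> lattice_vectors J"
    using w1 w2 by (auto simp: lattice_vectors_def m_def w_def)
  ultimately show ?thesis
    by (auto simp: \<beta>_def m_def)
qed

lemma card_lattice_vectors_le:
  assumes "finite J"
  shows "finite (lattice_vectors J)" "card (lattice_vectors J) \<le> 12 ^ card J"
proof -
  define S where "S = {z \<in> J \<rightarrow>\<^sub>E (UNIV :: int set). (\<Sum>j\<in>J. \<bar>z j\<bar>) \<le> int (2 * card J)}"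
  have sub: "lattice_vectors J \<subseteq> S"
    by (auto simp: lattice_vectors_def S_def)
  have fin: "finite S" and card: "card S \<le> 12 ^ card J"
    using card_integer_vectors_l1_le[OF assms, of 2] by (auto simp: S_def)
  show "finite (lattice_vectors J)"
    using finite_subset[OF sub fin] .
  show "card (lattice_vectors J) \<le> 12 ^ card J"
    using card_mono[OF fin sub] card by simp
qed

definition atoms :: "'i set \<Rightarrow> 'j set \<Rightarrow> ('i \<Rightarrow> 'j \<Rightarrow> real) set" where
  "atoms I J = (\<lambda>(\<sigma>, w) i j. \<sigma> i * real_of_int (w j) / sqrt (real (card J))) `
     ((I \<rightarrow>\<^sub>E {- 1, 1}) \<times> lattice_vectors J)"

lemma card_atoms_le:
  assumes "finite I" "finite J"
  shows "finite (atoms I J)" "card (atoms I J) \<le> 2 ^ card I * 12 ^ card J"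
proof -
  have fin: "finite (I \<rightarrow>\<^sub>E {- 1, 1 :: real})"
    using assms by (intro finite_PiE) auto
  then show "finite (atoms I J)"
    using assms by (auto simp: atoms_def intro!: finite_imageI finite_cartesian_product card_lattice_vectors_le)
  have "card (atoms I J) \<le> card ((I \<rightarrow>\<^sub>E {- 1, 1 :: real}) \<times> lattice_vectors J)"
    unfolding atoms_def using assms fin
    by (intro card_image_le finite_cartesian_product card_lattice_vectors_le)
  also have "\<dots> \<le> 2 ^ card I * 12 ^ card J"
    using assms card_lattice_vectors_le[of J]
    by (simp add: card_cartesian_product card_PiE numeral_2_eq_2[symmetric])
  finally show "card (atoms I J) \<le> 2 ^ card I * 12 ^ card J" .
qed

lemma atoms_row_le:
  assumes "finite J" "z \<in> atoms I J" "i \<in> I"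
  shows "L2_set (z i) J \<le> 2"
proof -
  obtain \<sigma> w where \<sigma>: "\<sigma> \<in> I \<rightarrow>\<^sub>E {- 1, 1}" and w: "w \<in> lattice_vectors J"
    and z: "z = (\<lambda>i j. \<sigma> i * real_of_int (w j) / sqrt (real (card J)))"
    using assms by (auto simp: atoms_def)
  have "\<sigma> i = - 1 \<or> \<sigma> i = 1"
    using \<sigma> \<open>i \<in> I\<close> by (auto simp: PiE_iff)
  then have "(\<sigma> i)\<^sup>2 = 1"
    by auto
  then have "(\<Sum>j\<in>J. (z i j)\<^sup>2) = real_of_int (\<Sum>j\<in>J. (w j)\<^sup>2) / real (card J)"
    by (simp add: z power_divide power_mult_distrib sum_divide_distrib)
  also have "\<dots> \<le> 4 * real (card J) / real (card J)"
  proof (rule divide_right_mono)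
    have "(\<Sum>j\<in>J. (w j)\<^sup>2) \<le> 4 * int (card J)"
      using w by (simp add: lattice_vectors_def)
    then show "real_of_int (\<Sum>j\<in>J. (w j)\<^sup>2) \<le> 4 * real (card J)"
      by linarith
  qed simp
  also have "\<dots> \<le> 2\<^sup>2"
    by simp
  finally show ?thesis
    unfolding L2_set_def by (rule real_le_lsqrt[rotated]) simp
qed

text \<open>
  A bilinear form on \<open>\<ell>\<^sub>\<infinity> \<times> \<ell>\<^sub>2\<close> attains its norm in the first argument at a sign vector, and in the
  second the lattice vectors are norming. Nonnegativity of the form at the atom lets the bound be summed
  over a decomposition of a tensor.
\<close>

lemma atoms_norming:
  fixes A :: "'i \<Rightarrow> 'j \<Rightarrow> real"
  assumes "finite I" "finite J" "J \<noteq> {}"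
    and x: "\<And>i. i \<in> I \<Longrightarrow> \<bar>x i\<bar> \<le> a" and "0 \<le> a"
  shows "\<exists>z\<in>atoms I J. 0 \<le> (\<Sum>i\<in>I. \<Sum>j\<in>J. A i j * z i j) \<and>
    (\<Sum>i\<in>I. \<Sum>j\<in>J. A i j * (x i * y j)) \<le> a * L2_set y J * (\<Sum>i\<in>I. \<Sum>j\<in>J. A i j * z i j)"
proof -
  define \<sigma> where "\<sigma> = (\<lambda>i\<in>I. if 0 \<le> (\<Sum>j\<in>J. A i j * y j) then 1 else - 1 :: real)"
  define b where "b = (\<lambda>j. \<Sum>i\<in>I. A i j * \<sigma> i)"
  obtain w where w: "w \<in> lattice_vectors J"
    and le: "L2_set b J \<le> (\<Sum>j\<in>J. real_of_int (w j) * b j) / sqrt (real (card J))"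
    using lattice_vectors_norming[OF assms(2,3), of b] by blast
  define z where "z = (\<lambda>i j. \<sigma> i * real_of_int (w j) / sqrt (real (card J)))"
  have "z \<in> atoms I J"
  proof -
    have "\<sigma> \<in> I \<rightarrow>\<^sub>E {- 1, 1}"
      by (simp add: \<sigma>_def PiE_iff)
    with w show ?thesis
      by (auto simp: atoms_def z_def intro!: image_eqI[where x = "(\<sigma>, w)"])
  qed
  have "(\<Sum>i\<in>I. \<Sum>j\<in>J. A i j * z i j) = (\<Sum>j\<in>J. real_of_int (w j) * b j) / sqrt (real (card J))"
    unfolding z_def b_def sum_divide_distrib sum_distrib_left
    by (subst sum.swap) (simp add: mult_ac)
  with le have le: "L2_set b J \<le> (\<Sum>i\<in>I. \<Sum>j\<in>J. A i j * z i j)"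
    by simp
  have "(\<Sum>i\<in>I. \<Sum>j\<in>J. A i j * (x i * y j)) = (\<Sum>i\<in>I. x i * (\<Sum>j\<in>J. A i j * y j))"
    by (simp add: sum_distrib_left mult_ac)
  also have "\<dots> \<le> (\<Sum>i\<in>I. a * (\<sigma> i * (\<Sum>j\<in>J. A i j * y j)))"
  proof (rule sum_mono)
    fix i assume i: "i \<in> I"
    have "x i * (\<Sum>j\<in>J. A i j * y j) \<le> \<bar>x i\<bar> * \<bar>\<Sum>j\<in>J. A i j * y j\<bar>"
      by (metis abs_ge_self abs_mult)
    also have "\<dots> \<le> a * \<bar>\<Sum>j\<in>J. A i j * y j\<bar>"
      using x[OF i] by (intro mult_right_mono) auto
    finally show "x i * (\<Sum>j\<in>J. A i j * y j) \<le> a * (\<sigma> i * (\<Sum>j\<in>J. A i j * y j))"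
      using i by (cases "0 \<le> (\<Sum>j\<in>J. A i j * y j)") (simp_all add: \<sigma>_def)
  qed
  also have "\<dots> = a * (\<Sum>j\<in>J. y j * b j)"
    unfolding b_def sum_distrib_left by (subst sum.swap) (simp add: mult_ac)
  also have "\<dots> \<le> a * (L2_set y J * L2_set b J)"
    using \<open>0 \<le> a\<close> abs_sum_mult_le_L2_set[of y b J] by (intro mult_left_mono) auto
  also have "\<dots> \<le> a * (L2_set y J * (\<Sum>i\<in>I. \<Sum>j\<in>J. A i j * z i j))"
    using \<open>0 \<le> a\<close> le by (intro mult_left_mono) auto
  finally show ?thesis
    using \<open>z \<in> atoms I J\<close> order_trans[OF L2_set_nonneg le] by (auto simp: mult_ac)
qed

section \<open>Coordinates and bounds for the two tensor norms\<close>

definition entries :: "('i \<times> 'j \<Rightarrow>\<^sub>0 real) \<Rightarrow> 'i \<Rightarrow> 'j \<Rightarrow> real" where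
  "entries T i j = Poly_Mapping.lookup T (i, j)"

lemma entries_tensor [simp]:
  "entries (tensor x y) i j = Poly_Mapping.lookup x i * Poly_Mapping.lookup y j"
  by (simp add: entries_def tensor.rep_eq)

lemma entries_add [simp]: "entries (S + T) i j = entries S i j + entries T i j"
  by (simp add: entries_def lookup_add)

lemma entries_diff [simp]: "entries (S - T) i j = entries S i j - entries T i j"
  by (simp add: entries_def lookup_minus)

lemma entries_zero [simp]: "entries 0 i j = 0"
  by (simp add: entries_def)

lemma entries_scaleR [simp]: "entries (c *\<^sub>R T) i j = c * entries T i j"
  by (simp add: entries_def lookup_scaleR)

lemma lookup_single_sum:
  assumes "finite A"
  shows "Poly_Mapping.lookup (\<Sum>i\<in>A. Poly_Mapping.single i (a i)) k = (if k \<in> A then a k else 0)"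
  using assms by (simp add: lookup_sum lookup_single when_def sum.delta')

lemma keys_single_sum_subset:
  "Poly_Mapping.keys (\<Sum>i\<in>A. Poly_Mapping.single i (a i)) \<subseteq> A"
  by (cases "finite A") (auto simp: in_keys_iff lookup_single_sum split: if_splits)

lemma linear_single_sum:
  fixes f :: "('i \<Rightarrow>\<^sub>0 real) \<Rightarrow> real"
  assumes "linear f"
  shows "f (\<Sum>i\<in>A. Poly_Mapping.single i (a i)) = (\<Sum>i\<in>A. a i * f (Poly_Mapping.single i 1))"
proof -
  have scale: "Poly_Mapping.single i c = c *\<^sub>R Poly_Mapping.single i (1 :: real)" for i :: 'i and c
    by (rule poly_mapping_eqI) (simp add: lookup_single lookup_scaleR when_def)
  have "f (Poly_Mapping.single i c) = c * f (Poly_Mapping.single i 1)" for i c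
    by (subst scale) (simp add: linear_cmul[OF assms])
  then show ?thesis
    unfolding linear_sum[OF assms] by (rule sum.cong[OF refl])
qed

lemma subspace_keys: "subspace {x :: 'i \<Rightarrow>\<^sub>0 real. Poly_Mapping.keys x \<subseteq> A}"
  by (auto simp: subspace_def in_keys_iff lookup_add lookup_scaleR subset_iff) (metis add_0)

text \<open>
  The dual norm of \<open>\<ell>\<^sub>\<infinity>\<close> is the \<open>\<ell>\<^sub>1\<close> norm: evaluate at the vector of signs.
\<close>

lemma linf_dual_ball_sum_le:
  assumes "f \<in> dual_ball (linf_space n)" "0 < n"
  shows "(\<Sum>i<n. \<bar>f (Poly_Mapping.single i 1)\<bar>) \<le> 1"
proof -
  define x where "x = (\<Sum>i<n. Poly_Mapping.single i (sgn (f (Poly_Mapping.single i 1))))"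
  have "x \<in> unit_ball (linf_space n)"
  proof -
    have "\<bar>Poly_Mapping.lookup x i\<bar> \<le> 1" for i
      by (simp add: x_def lookup_single_sum abs_sgn_eq)
    moreover have "Poly_Mapping.keys x \<subseteq> {..<n}"
      unfolding x_def by (rule keys_single_sum_subset)
    moreover have "{..<n} \<noteq> {}"
      using \<open>0 < n\<close> by auto
    ultimately show ?thesis
      by (simp add: unit_ball_def linf_space_def)
  qed
  then have "\<bar>f x\<bar> \<le> 1"
    using assms by (simp add: dual_ball_def)
  moreover have "f x = (\<Sum>i<n. \<bar>f (Poly_Mapping.single i 1)\<bar>)"
  proof -
    have "linear f"
      using assms by (simp add: dual_ball_def)
    then show ?thesis
      unfolding x_def by (subst linear_single_sum) (auto simp: sgn_if intro!: sum.cong)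
  qed
  ultimately show ?thesis
    by simp
qed

lemma l2_dual_ball_sum_le:
  assumes "g \<in> dual_ball (l2_space m)"
  shows "\<bar>\<Sum>j<m. t j * g (Poly_Mapping.single j 1)\<bar> \<le> L2_set t {..<m}"
proof (cases "L2_set t {..<m} = 0")
  case True
  then show ?thesis
    by (simp add: L2_set_eq_0_iff)
next
  case False
  define c where "c = L2_set t {..<m}"
  have c: "0 < c"
    using False L2_set_nonneg[of t "{..<m}"] unfolding c_def by linarith
  define y where "y = (\<Sum>j<m. Poly_Mapping.single j (t j * (1 / c)))"
  have "L2_set (Poly_Mapping.lookup y) {..<m} = L2_set (\<lambda>j. t j * (1 / c)) {..<m}"
    by (intro L2_set_cong) (auto simp: y_def lookup_single_sum)
  also have "\<dots> = 1"
    using c by (subst L2_set_left_distrib[symmetric]) (auto simp flip: c_def)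
  finally have "L2_set (Poly_Mapping.lookup y) {..<m} = 1" .
  moreover have "Poly_Mapping.keys y \<subseteq> {..<m}"
    unfolding y_def by (rule keys_single_sum_subset)
  ultimately have "y \<in> unit_ball (l2_space m)"
    by (simp add: unit_ball_def l2_space_def)
  then have "\<bar>g y\<bar> \<le> 1"
    using assms by (simp add: dual_ball_def)
  moreover have "g y = (\<Sum>j<m. t j * g (Poly_Mapping.single j 1)) / c"
    using assms unfolding y_def
    by (subst linear_single_sum) (auto simp: dual_ball_def sum_divide_distrib)
  ultimately have "\<bar>\<Sum>j<m. t j * g (Poly_Mapping.single j 1)\<bar> / c \<le> 1"
    using c by simp
  then show ?thesis
    using c unfolding c_def[symmetric] by (simp only: divide_le_eq_1_pos)
qed

lemma tensor_pts_keys: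
  assumes "T \<in> tensor_pts (linf_space n) (l2_space m)"
  shows "Poly_Mapping.keys T \<subseteq> {..<n} \<times> {..<m}"
proof -
  have "tensor_pts (linf_space n) (l2_space m) \<subseteq> {T. Poly_Mapping.keys T \<subseteq> {..<n} \<times> {..<m}}"
    unfolding tensor_pts_def
    by (intro span_minimal subspace_keys)
      (fastforce simp: linf_space_def l2_space_def in_keys_iff tensor.rep_eq)
  with assms show ?thesis
    by blast
qed

lemma injective_norm_le:
  assumes T: "T \<in> tensor_pts (linf_space n) (l2_space m)" and "0 < n" "0 \<le> r"
    and row: "\<And>i. i < n \<Longrightarrow> L2_set (entries T i) {..<m} \<le> r"
  shows "nrm (injective_tensor (linf_space n) (l2_space m)) T \<le> r"
proof -
  have "\<bar>tensor_pairing f g T\<bar> \<le> r"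
    if f: "f \<in> dual_ball (linf_space n)" and g: "g \<in> dual_ball (l2_space m)" for f g
  proof -
    let ?f = "\<lambda>i. f (Poly_Mapping.single i 1)" and ?g = "\<lambda>j. g (Poly_Mapping.single j 1)"
    have "tensor_pairing f g T = (\<Sum>(i, j)\<in>{..<n} \<times> {..<m}. entries T i j * ?f i * ?g j)"
      unfolding tensor_pairing_def entries_def
      using tensor_pts_keys[OF T] by (intro sum.mono_neutral_left) (auto simp: in_keys_iff)
    also have "\<dots> = (\<Sum>i<n. ?f i * (\<Sum>j<m. entries T i j * ?g j))"
      by (simp add: sum.cartesian_product[symmetric] sum_distrib_left mult_ac)
    finally have "\<bar>tensor_pairing f g T\<bar> \<le> (\<Sum>i<n. \<bar>?f i\<bar> * \<bar>\<Sum>j<m. entries T i j * ?g j\<bar>)"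
      by (simp add: sum_abs flip: abs_mult)
    also have "\<dots> \<le> (\<Sum>i<n. \<bar>?f i\<bar> * r)"
      using l2_dual_ball_sum_le[OF g] row by (intro sum_mono mult_left_mono) (auto intro: order_trans)
    also have "\<dots> = (\<Sum>i<n. \<bar>?f i\<bar>) * r"
      by (simp add: sum_distrib_right)
    also have "\<dots> \<le> 1 * r"
      using linf_dual_ball_sum_le[OF f] assms by (intro mult_right_mono) auto
    finally show ?thesis
      by simp
  qed
  moreover have "(\<lambda>_. 0) \<in> dual_ball (linf_space n)" "(\<lambda>_. 0) \<in> dual_ball (l2_space m)"
    by (auto simp: dual_ball_def linear_zero)
  ultimately have "Sup {\<bar>tensor_pairing f g T\<bar> | f g. f \<in> dual_ball (linf_space n) \<and> g \<in> dual_ball (l2_space m)} \<le> r"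
    by (intro cSup_least) blast+
  then show ?thesis
    by (simp add: injective_tensor_def)
qed

lemma scaled_injective_ballI:
  assumes T: "T \<in> tensor_pts (linf_space n) (l2_space m)" and "0 < n" "0 < r"
    and row: "\<And>i. i < n \<Longrightarrow> L2_set (entries T i) {..<m} \<le> r"
  shows "T \<in> (\<lambda>y. r *\<^sub>R y) ` unit_ball (injective_tensor (linf_space n) (l2_space m))"
proof (rule image_eqI)
  show "T = r *\<^sub>R ((1 / r) *\<^sub>R T)"
    using \<open>0 < r\<close> by simp
  have pts: "(1 / r) *\<^sub>R T \<in> tensor_pts (linf_space n) (l2_space m)"
    using T unfolding tensor_pts_def by (rule span_mul)
  have "L2_set (entries ((1 / r) *\<^sub>R T) i) {..<m} \<le> 1" if "i < n" for i
  proof -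
    have "L2_set (entries ((1 / r) *\<^sub>R T) i) {..<m} = (1 / r) * L2_set (entries T i) {..<m}"
      using \<open>0 < r\<close> by (subst L2_set_right_distrib) (auto intro!: L2_set_cong)
    then show ?thesis
      using row[OF that] \<open>0 < r\<close> by simp
  qed
  then have "nrm (injective_tensor (linf_space n) (l2_space m)) ((1 / r) *\<^sub>R T) \<le> 1"
    using pts \<open>0 < n\<close> by (intro injective_norm_le) auto
  with pts show "(1 / r) *\<^sub>R T \<in> unit_ball (injective_tensor (linf_space n) (l2_space m))"
    by (simp add: unit_ball_def injective_tensor_def)
qed

lemma tensor_scaleR_left: "tensor (c *\<^sub>R x) y = c *\<^sub>R tensor x y"
  by (rule poly_mapping_eqI) (auto simp: tensor.rep_eq lookup_scaleR split: prod.splits)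

lemma tensor_pts_sum_of_tensors:
  assumes "subspace (pts X)" "T \<in> tensor_pts X Y"
  shows "\<exists>(l::nat) x y. (\<forall>k<l. x k \<in> pts X \<and> y k \<in> pts Y) \<and> T = (\<Sum>k<l. tensor (x k) (y k))"
  using assms(2) unfolding tensor_pts_def
proof (induction rule: span_induct_alt)
  case base
  show ?case
    by (rule exI[of _ 0]) auto
next
  case (step c t T)
  obtain u v where t: "t = tensor u v" "u \<in> pts X" "v \<in> pts Y"
    using step(1) by blast
  obtain l x y where T: "\<forall>k<(l::nat). x k \<in> pts X \<and> y k \<in> pts Y" "T = (\<Sum>k<l. tensor (x k) (y k))"
    using step(2) by (elim exE conjE)
  have "c *\<^sub>R u \<in> pts X"
    using assms(1) t by (simp add: subspace_scale)
  then show ?case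
    using t T 
    by (intro exI[of _ "Suc l"] exI[of _ "x(l := c *\<^sub>R u)"] exI[of _ "y(l := v)"])
      (auto simp: tensor_scaleR_left less_Suc_eq add.commute)
qed

text \<open>
  Bound \<open>\<phi>\<close> along a decomposition \<open>T = \<Sum>k. x\<^sub>k \<otimes> y\<^sub>k\<close> term by term and take the infimum over the
  decompositions, which need not be attained. Sublinearity in place of linearity covers the norm of a row.
\<close>

lemma sublinear_le_on_projective_ball:
  assumes "subspace (pts X)" and T: "T \<in> unit_ball (projective_tensor X Y)" and "0 \<le> c"
    and zero: "\<phi> 0 \<le> (0 :: real)" and add: "\<And>S T. \<phi> (S + T) \<le> \<phi> S + \<phi> T"
    and tensor: "\<And>x y. x \<in> pts X \<Longrightarrow> y \<in> pts Y \<Longrightarrow> \<phi> (tensor x y) \<le> c * (nrm X x * nrm Y y)"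
  shows "\<phi> T \<le> c"
proof -
  define V where "V = {\<Sum>k<l. nrm X (x k) * nrm Y (y k) | (l::nat) x y.
    (\<forall>k<l. x k \<in> pts X \<and> y k \<in> pts Y) \<and> T = (\<Sum>k<l. tensor (x k) (y k))}"
  have pts: "T \<in> tensor_pts X Y" and Inf: "Inf V \<le> 1"
    using T by (simp_all add: unit_ball_def projective_tensor_def V_def)
  have ne: "V \<noteq> {}"
    using tensor_pts_sum_of_tensors[OF assms(1) pts] unfolding V_def by blast
  have le: "\<phi> T \<le> c * v" if "v \<in> V" for v
  proof -
    obtain l x y where xy: "\<forall>k<(l::nat). x k \<in> pts X \<and> y k \<in> pts Y"
      and T: "T = (\<Sum>k<l. tensor (x k) (y k))" and v: "v = (\<Sum>k<l. nrm X (x k) * nrm Y (y k))"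
      using \<open>v \<in> V\<close> unfolding V_def by blast
    have "\<phi> (\<Sum>k<l'. tensor (x k) (y k)) \<le> (\<Sum>k<l'. c * (nrm X (x k) * nrm Y (y k)))" if "l' \<le> l" for l'
      using that
    proof (induction l')
      case (Suc l')
      have "\<phi> (\<Sum>k<Suc l'. tensor (x k) (y k)) \<le> \<phi> (\<Sum>k<l'. tensor (x k) (y k)) + \<phi> (tensor (x l') (y l'))"
        by (simp add: add)
      also have "\<dots> \<le> (\<Sum>k<Suc l'. c * (nrm X (x k) * nrm Y (y k)))"
        using Suc tensor xy by (simp add: add_mono)
      finally show ?case .
    qed (simp add: zero)
    from this[of l] show ?thesis
      by (simp add: T v sum_distrib_left)
  qed
  show ?thesis
  proof (cases "c = 0")
    case True
    then show ?thesis
      using le ne by auto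
  next
    case False
    with \<open>0 \<le> c\<close> have "0 < c"
      by simp
    then have "\<phi> T / c \<le> Inf V"
      using ne le by (intro cInf_greatest) (auto simp: field_simps)
    with Inf have "\<phi> T / c \<le> 1"
      by linarith
    with \<open>0 < c\<close> show ?thesis
      by simp
  qed
qed

lemma subspace_pts_linf: "subspace (pts (linf_space n))"
  by (simp add: linf_space_def subspace_keys)

lemma abs_lookup_le_linf_norm: "i < n \<Longrightarrow> \<bar>Poly_Mapping.lookup x i\<bar> \<le> nrm (linf_space n) x"
  by (auto simp: linf_space_def intro!: Max_ge)

lemma linf_norm_nonneg: "0 < n \<Longrightarrow> 0 \<le> nrm (linf_space n) x"
  using abs_lookup_le_linf_norm[of 0 n x] by linarith

lemma projective_ball_row_le:
  assumes "T \<in> unit_ball (projective_tensor (linf_space n) (l2_space m))" "i < n"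
  shows "L2_set (entries T i) {..<m} \<le> 1"
proof -
  have tensor: "L2_set (entries (tensor x y) i) {..<m} \<le> 1 * (nrm (linf_space n) x * nrm (l2_space m) y)"
    for x y :: "nat \<Rightarrow>\<^sub>0 real"
  proof -
    have "L2_set (entries (tensor x y) i) {..<m} = \<bar>Poly_Mapping.lookup x i\<bar> * nrm (l2_space m) y"
      by (simp add: l2_space_def L2_set_def power_mult_distrib real_sqrt_mult flip: sum_distrib_left)
    also have "\<dots> \<le> nrm (linf_space n) x * nrm (l2_space m) y"
      using abs_lookup_le_linf_norm[OF assms(2)] by (intro mult_right_mono) (auto simp: l2_space_def)
    finally show ?thesis
      by simp
  qed
  have add: "L2_set (entries (S + T) i) {..<m} \<le> L2_set (entries S i) {..<m} + L2_set (entries T i) {..<m}"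
    for S T :: "nat \<times> nat \<Rightarrow>\<^sub>0 real"
  proof -
    have "L2_set (entries (S + T) i) {..<m} = L2_set (\<lambda>j. entries S i j + entries T i j) {..<m}"
      by (rule L2_set_cong) auto
    then show ?thesis
      using L2_set_triangle_ineq[of "entries S i" "entries T i" "{..<m}"] by linarith
  qed
  have zero: "L2_set (entries 0 i) {..<m} \<le> 0"
    by (simp add: L2_set_def)
  show ?thesis
    by (rule sublinear_le_on_projective_ball[where \<phi> = "\<lambda>T. L2_set (entries T i) {..<m}",
          OF subspace_pts_linf assms(1) zero_le_one zero add tensor])
qed

text \<open>
  Among the atoms take one that maximises the functional \<open>- A\<close>. By \<open>atoms_norming\<close> the maximum
  dominates \<open>- A\<close> on elementary tensors, hence on the whole unit ball.
\<close>

lemma projective_ball_atoms: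
  assumes "T \<in> unit_ball (projective_tensor (linf_space n) (l2_space m))" "0 < n" "0 < m"
  shows "\<exists>z\<in>atoms {..<n} {..<m}. (\<Sum>i<n. \<Sum>j<m. A i j * z i j) \<le> (\<Sum>i<n. \<Sum>j<m. A i j * entries T i j)"
proof -
  define F where "F = atoms {..<n} {..<m}"
  define p where "p = (\<lambda>z. \<Sum>i<n. \<Sum>j<m. - A i j * z i j)"
  have norming: "\<exists>z\<in>F. 0 \<le> p z \<and> p (entries (tensor x y)) \<le> nrm (linf_space n) x * nrm (l2_space m) y * p z" for x y
    using atoms_norming[of "{..<n}" "{..<m}" "Poly_Mapping.lookup x" "nrm (linf_space n) x" "\<lambda>i j. - A i j" "Poly_Mapping.lookup y"]
      assms abs_lookup_le_linf_norm[of _ n x] linf_norm_nonneg[of n x]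
    by (auto simp: p_def F_def l2_space_def)
  have "finite F"
    by (simp add: F_def card_atoms_le)
  moreover have "F \<noteq> {}"
    using norming by blast
  ultimately have "Max (p ` F) \<in> p ` F"
    by (intro Max_in) auto
  then obtain z where z: "z \<in> F" "p z = Max (p ` F)"
    by auto
  then have max: "p w \<le> p z" if "w \<in> F" for w
    using that \<open>finite F\<close> by simp
  have "p (entries T) \<le> p z"
  proof (rule sublinear_le_on_projective_ball[where \<phi> = "\<lambda>T. p (entries T)", OF subspace_pts_linf assms(1)])
    show "0 \<le> p z"
      using norming[of 0 0] max by fastforce
    show "p (entries 0) \<le> 0"
      by (simp add: p_def)
    show "p (entries (S + T)) \<le> p (entries S) + p (entries T)" for S T
      by (simp add: p_def sum.distrib distrib_left sum_subtractf sum_negf algebra_simps)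
    fix x y :: "nat \<Rightarrow>\<^sub>0 real"
    obtain w where w: "w \<in> F" and le: "p (entries (tensor x y)) \<le> nrm (linf_space n) x * nrm (l2_space m) y * p w"
      using norming by blast
    note le
    also have "\<dots> \<le> nrm (linf_space n) x * nrm (l2_space m) y * p z"
      using max[OF w] linf_norm_nonneg[OF \<open>0 < n\<close>] by (intro mult_left_mono) (auto simp: l2_space_def)
    finally show "p (entries (tensor x y)) \<le> p z * (nrm (linf_space n) x * nrm (l2_space m) y)"
      by (simp add: mult_ac)
  qed
  with z(1) show ?thesis
    by (auto simp: p_def F_def sum_negf)
qed

section \<open>Coverings by pieces of small diameter\<close>

text \<open>
  Pieces of small diameter are used instead of balls: the pigeonhole principle then bounds packing
  numbers at the same scale \<open>\<epsilon>\<close>. The distance is that of \<open>\<ell>\<^sub>\<infinity>(\<ell>\<^sub>2)\<close>, written out row by row.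
\<close>

definition row_covered :: "'i set \<Rightarrow> 'j set \<Rightarrow> ('i \<Rightarrow> 'j \<Rightarrow> real) set \<Rightarrow> real \<Rightarrow> nat \<Rightarrow> bool" where
  "row_covered I J A \<epsilon> N \<longleftrightarrow> (\<exists>P. finite P \<and> card P \<le> N \<and> A \<subseteq> \<Union>P \<and>
     (\<forall>p\<in>P. \<forall>S\<in>p. \<forall>T\<in>p. \<forall>i\<in>I. L2_set (\<lambda>j. S i j - T i j) J \<le> \<epsilon>))"

text \<open>
  Read \<open>R T c\<close> as: \<open>c\<close> is a code for \<open>T\<close>. Points that share a code form a piece.
\<close>

lemma row_covered_by_codes:
  assumes "finite C" "card C \<le> N"
    and "\<And>T. T \<in> A \<Longrightarrow> \<exists>c\<in>C. R T c"
    and "\<And>S T c i. S \<in> A \<Longrightarrow> T \<in> A \<Longrightarrow> R S c \<Longrightarrow> R T c \<Longrightarrow> i \<in> I \<Longrightarrow> L2_set (\<lambda>j. S i j - T i j) J \<le> \<epsilon>"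
  shows "row_covered I J A \<epsilon> N"
  unfolding row_covered_def
proof (intro exI conjI)
  show "finite ((\<lambda>c. {T \<in> A. R T c}) ` C)"
    using assms(1) by simp
  show "card ((\<lambda>c. {T \<in> A. R T c}) ` C) \<le> N"
    using card_image_le[OF assms(1)] assms(2) by (rule order_trans)
  show "A \<subseteq> \<Union> ((\<lambda>c. {T \<in> A. R T c}) ` C)"
    using assms(3) by auto
  show "\<forall>p\<in>(\<lambda>c. {T \<in> A. R T c}) ` C. \<forall>S\<in>p. \<forall>T\<in>p. \<forall>i\<in>I. L2_set (\<lambda>j. S i j - T i j) J \<le> \<epsilon>"
    using assms(4) by auto
qed

lemma row_covered_mono:
  assumes "row_covered I J A \<epsilon> N" "N \<le> N'" "\<epsilon> \<le> \<epsilon>'"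
  shows "row_covered I J A \<epsilon>' N'"
  using assms unfolding row_covered_def by (meson order_trans)

lemma row_covered_refine:
  assumes "row_covered I J A \<epsilon> N"
    and piece: "\<And>B. (\<And>S T i. S \<in> B \<Longrightarrow> T \<in> B \<Longrightarrow> i \<in> I \<Longrightarrow> L2_set (\<lambda>j. S i j - T i j) J \<le> \<epsilon>) \<Longrightarrow>
      row_covered I J B \<delta> M"
  shows "row_covered I J A \<delta> (N * M)"
proof -
  obtain P where P: "finite P" "card P \<le> N" "A \<subseteq> \<Union>P"
    and diam: "\<forall>p\<in>P. \<forall>S\<in>p. \<forall>T\<in>p. \<forall>i\<in>I. L2_set (\<lambda>j. S i j - T i j) J \<le> \<epsilon>"
    using assms(1) unfolding row_covered_def by blast
  have "\<forall>p\<in>P. \<exists>Q. finite Q \<and> card Q \<le> M \<and> p \<subseteq> \<Union>Q \<and>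
      (\<forall>q\<in>Q. \<forall>S\<in>q. \<forall>T\<in>q. \<forall>i\<in>I. L2_set (\<lambda>j. S i j - T i j) J \<le> \<delta>)"
  proof
    fix p assume "p \<in> P"
    then have "row_covered I J p \<delta> M"
      using diam by (intro piece) blast
    then show "\<exists>Q. finite Q \<and> card Q \<le> M \<and> p \<subseteq> \<Union>Q \<and>
      (\<forall>q\<in>Q. \<forall>S\<in>q. \<forall>T\<in>q. \<forall>i\<in>I. L2_set (\<lambda>j. S i j - T i j) J \<le> \<delta>)"
      by (simp add: row_covered_def)
  qed
  from bchoice[OF this] obtain Q where Q: "\<forall>p\<in>P. finite (Q p) \<and> card (Q p) \<le> M \<and> p \<subseteq> \<Union>(Q p) \<and>
      (\<forall>q\<in>Q p. \<forall>S\<in>q. \<forall>T\<in>q. \<forall>i\<in>I. L2_set (\<lambda>j. S i j - T i j) J \<le> \<delta>)"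
    by (elim exE)
  have Q_sub: "p \<subseteq> \<Union>(Q p)" if "p \<in> P" for p
    using Q that by simp
  show ?thesis
    unfolding row_covered_def
  proof (intro exI conjI)
    show "finite (\<Union>p\<in>P. Q p)"
      using P(1) Q by simp
    have "card (\<Union>p\<in>P. Q p) \<le> (\<Sum>p\<in>P. card (Q p))"
      by (rule card_UN_le[OF P(1)])
    also have "\<dots> \<le> (\<Sum>p\<in>P. M)"
      using Q by (intro sum_mono) simp
    also have "\<dots> \<le> N * M"
      using P(2) by simp
    finally show "card (\<Union>p\<in>P. Q p) \<le> N * M" .
    show "A \<subseteq> \<Union> (\<Union>p\<in>P. Q p)"
    proof
      fix T assume "T \<in> A"
      then obtain p where p: "p \<in> P" "T \<in> p"
        using P(3) by blast
      then obtain q where "q \<in> Q p" "T \<in> q"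
        using Q_sub[OF p(1)] by blast
      with p(1) show "T \<in> \<Union> (\<Union>p\<in>P. Q p)"
        by (intro UnionI[of q] UN_I)
    qed
    show "\<forall>q\<in>\<Union>p\<in>P. Q p. \<forall>S\<in>q. \<forall>T\<in>q. \<forall>i\<in>I. L2_set (\<lambda>j. S i j - T i j) J \<le> \<delta>"
      using Q by simp
  qed
qed

text \<open>
  The codes are the \<open>N\<close>-tuples of points of \<open>F\<close>, and a tuple encodes the matrices near its average.
\<close>

lemma row_covered_empirical:
  fixes F A :: "('i \<Rightarrow> 'j \<Rightarrow> real) set"
  assumes "finite I" "finite F" "0 < b" "0 < N"
    and bnd: "\<And>T z i. T \<in> A \<Longrightarrow> z \<in> F \<Longrightarrow> i \<in> I \<Longrightarrow> L2_set (\<lambda>j. z i j - T i j) J \<le> b"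
    and hull: "\<And>T B. T \<in> A \<Longrightarrow> \<exists>z\<in>F. (\<Sum>i\<in>I. \<Sum>j\<in>J. B i j * z i j) \<le> (\<Sum>i\<in>I. \<Sum>j\<in>J. B i j * T i j)"
  shows "row_covered I J A (2 * b * sqrt (2 * ln (2 * real (card I)) / real N)) (card F ^ N)"
proof -
  define \<rho> where "\<rho> = b * sqrt (2 * ln (2 * real (card I)) / real N)"
  define R where "R = (\<lambda>(T :: 'i \<Rightarrow> 'j \<Rightarrow> real) z. \<forall>i\<in>I. L2_set (\<lambda>j. (\<Sum>k<N. z k i j) / real N - T i j) J \<le> \<rho>)"
  have "row_covered I J A (2 * \<rho>) (card F ^ N)"
  proof (rule row_covered_by_codes[where R = R])
    show "finite ({..<N} \<rightarrow>\<^sub>E F)"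
      using assms by (intro finite_PiE) auto
    show "card ({..<N} \<rightarrow>\<^sub>E F) \<le> card F ^ N"
      by (simp add: card_PiE)
    show "\<exists>z\<in>{..<N} \<rightarrow>\<^sub>E F. R T z" if "T \<in> A" for T
    proof -
      have "\<exists>z. (\<forall>k<N. z k \<in> F) \<and> R T z"
        unfolding R_def \<rho>_def using assms(1,3,4) bnd[OF that] hull[OF that]
        by (intro empirical_approximation) 
      then obtain z where z: "\<forall>k<N. z k \<in> F" "R T z"
        by blast
      show ?thesis
      proof (rule bexI[of _ "restrict z {..<N}"])
        show "R T (restrict z {..<N})"
          using z(2) by (simp add: R_def)
        show "restrict z {..<N} \<in> {..<N} \<rightarrow>\<^sub>E F"
          using z(1) by simp
      qed
    qed
    show "L2_set (\<lambda>j. S i j - T i j) J \<le> 2 * \<rho>" if "R S z" "R T z" "i \<in> I" for S T z i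
    proof -
      define h where "h = (\<lambda>j. (\<Sum>k<N. z k i j) / real N)"
      have "L2_set (\<lambda>j. S i j - T i j) J = L2_set (\<lambda>j. (h j - T i j) + - (h j - S i j)) J"
        by simp
      also have "\<dots> \<le> L2_set (\<lambda>j. h j - T i j) J + L2_set (\<lambda>j. - (h j - S i j)) J"
        by (rule L2_set_triangle_ineq)
      also have "L2_set (\<lambda>j. - (h j - S i j)) J = L2_set (\<lambda>j. h j - S i j) J"
        by (simp add: L2_set_def power2_commute)
      finally show ?thesis
        using that by (fastforce simp: R_def h_def)
    qed
  qed
  then show ?thesis
    by (simp add: \<rho>_def mult.assoc)
qed

text \<open>
  After a translation that moves a point of \<open>B\<close> to the origin, round every entry down to a multiple
  of \<open>\<epsilon> / (2 * sqrt (card J))\<close>. By Cauchy--Schwarz the resulting integer matrices have \<open>\<ell>\<^sub>1\<close> norm at most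
  \<open>3 * card (I \<times> J)\<close>, where one third accounts for the rounding. So there are few of them.
\<close>

lemma row_covered_half:
  fixes B :: "('i \<Rightarrow> 'j \<Rightarrow> real) set"
  assumes "finite I" "finite J" "J \<noteq> {}" "0 < \<epsilon>"
    and diam: "\<And>S T i. S \<in> B \<Longrightarrow> T \<in> B \<Longrightarrow> i \<in> I \<Longrightarrow> L2_set (\<lambda>j. S i j - T i j) J \<le> \<epsilon>"
  shows "row_covered I J B (\<epsilon> / 2) (24 ^ (card I * card J))"
proof (cases "B = {}")
  case True
  then show ?thesis
    unfolding row_covered_def by (intro exI[of _ "{}"]) auto
next
  case False
  then obtain V where V: "V \<in> B"
    by blast
  define s where "s = sqrt (real (card J))"
  have card: "0 < card J"
    using assms by (simp add: card_gt_0_iff)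
  then have s: "0 < s"
    by (simp add: s_def)
  have ss: "s * s = real (card J)"
    by (simp add: s_def)
  define u where "u = (\<lambda>T i j. 2 * s / \<epsilon> * (T i j - V i j))"
  define code where "code = (\<lambda>T. \<lambda>(i, j)\<in>I \<times> J. \<lfloor>u T i j\<rfloor>)"
  define C where "C = {z \<in> (I \<times> J) \<rightarrow>\<^sub>E (UNIV :: int set). (\<Sum>p\<in>I \<times> J. \<bar>z p\<bar>) \<le> int (3 * card (I \<times> J))}"
  show ?thesis
  proof (rule row_covered_by_codes[where R = "\<lambda>T c. code T = c"])
    show "finite C"
      unfolding C_def using assms by (intro card_integer_vectors_l1_le) auto
    have "card C \<le> (3 * 2 ^ 3) ^ card (I \<times> J)"
      unfolding C_def using assms by (intro card_integer_vectors_l1_le) auto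
    then show "card C \<le> 24 ^ (card I * card J)"
      by (simp add: card_cartesian_product)
    show "\<exists>c\<in>C. code T = c" if T: "T \<in> B" for T
    proof -
      have row: "(\<Sum>j\<in>J. \<bar>u T i j\<bar>) \<le> 2 * real (card J)" if i: "i \<in> I" for i
      proof -
        have "(\<Sum>j\<in>J. \<bar>T i j - V i j\<bar>) \<le> L2_set (\<lambda>j. T i j - V i j) J * s"
          using L2_set_mult_ineq[of "\<lambda>j. T i j - V i j" "\<lambda>_. 1" J] by (simp add: L2_set_constant s_def)
        also have "\<dots> \<le> \<epsilon> * s"
          using diam[OF T V i] s by (intro mult_right_mono) auto
        finally have "2 * s / \<epsilon> * (\<Sum>j\<in>J. \<bar>T i j - V i j\<bar>) \<le> 2 * s / \<epsilon> * (\<epsilon> * s)"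
          using s \<open>0 < \<epsilon>\<close> by (intro mult_left_mono) auto
        also have "\<dots> = 2 * real (card J)"
          using \<open>0 < \<epsilon>\<close> ss by simp
        finally show ?thesis
          using s \<open>0 < \<epsilon>\<close> by (simp add: u_def abs_mult sum_distrib_left)
      qed
      have "real_of_int (\<Sum>p\<in>I \<times> J. \<bar>code T p\<bar>) = (\<Sum>i\<in>I. \<Sum>j\<in>J. real_of_int \<bar>\<lfloor>u T i j\<rfloor>\<bar>)"
        by (simp add: code_def sum.cartesian_product split_beta)
      also have "\<dots> \<le> (\<Sum>i\<in>I. \<Sum>j\<in>J. \<bar>u T i j\<bar> + 1)"
        by (intro sum_mono) linarith
      also have "\<dots> \<le> (\<Sum>i\<in>I. 3 * real (card J))"
        using row by (intro sum_mono) (fastforce simp: sum.distrib)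
      also have "\<dots> = real_of_int (int (3 * card (I \<times> J)))"
        by (simp add: card_cartesian_product)
      finally have "(\<Sum>p\<in>I \<times> J. \<bar>code T p\<bar>) \<le> int (3 * card (I \<times> J))"
        by linarith
      then show ?thesis
        by (auto simp: C_def code_def)
    qed
    show "L2_set (\<lambda>j. S i j - T i j) J \<le> \<epsilon> / 2" if "code S = c" "code T = c" "i \<in> I" for S T c i
    proof -
      have coord: "\<bar>S i j - T i j\<bar> \<le> \<epsilon> / (2 * s)" if "j \<in> J" for j
      proof -
        have "\<lfloor>u S i j\<rfloor> = \<lfloor>u T i j\<rfloor>"
        proof -
          have "code S (i, j) = code T (i, j)"
            using \<open>code S = c\<close> \<open>code T = c\<close> by simp
          then show ?thesis
            using \<open>i \<in> I\<close> that by (simp add: code_def)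
        qed
        then have "\<bar>u S i j - u T i j\<bar> \<le> 1"
          by linarith
        also have "u S i j - u T i j = 2 * s / \<epsilon> * (S i j - T i j)"
          unfolding u_def right_diff_distrib[symmetric] by simp
        finally have "\<bar>S i j - T i j\<bar> * (2 * s / \<epsilon>) \<le> 1"
          using s \<open>0 < \<epsilon>\<close> by (simp add: abs_mult mult.commute)
        then have "\<bar>S i j - T i j\<bar> \<le> 1 / (2 * s / \<epsilon>)"
          using s \<open>0 < \<epsilon>\<close> by (subst pos_le_divide_eq) auto
        then show ?thesis
          by simp
      qed
      have "L2_set (\<lambda>j. S i j - T i j) J = L2_set (\<lambda>j. \<bar>S i j - T i j\<bar>) J"
        by (simp add: L2_set_def)
      also have "\<dots> \<le> L2_set (\<lambda>j. \<epsilon> / (2 * s)) J"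
        using coord by (intro L2_set_mono) auto
      also have "\<dots> = \<epsilon> / 2"
        using s \<open>0 < \<epsilon>\<close> by (simp add: L2_set_constant flip: s_def)
      finally show ?thesis .
    qed
  qed
qed

lemma row_covered_halvings:
  assumes "finite I" "finite J" "J \<noteq> {}" "0 < \<epsilon>" "row_covered I J A \<epsilon> N"
  shows "row_covered I J A (\<epsilon> / 2 ^ k) (N * 24 ^ (card I * card J * k))"
proof (induction k)
  case (Suc k)
  have "row_covered I J A (\<epsilon> / 2 ^ k / 2) (N * 24 ^ (card I * card J * k) * 24 ^ (card I * card J))"
    using assms(1-4) by (intro row_covered_refine[OF Suc.IH] row_covered_half) auto
  moreover have "N * 24 ^ (card I * card J * k) * 24 ^ (card I * card J) = N * 24 ^ (card I * card J * Suc k)"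
    by (simp add: power_add)
  moreover have "\<epsilon> / 2 ^ k / 2 = \<epsilon> / 2 ^ Suc k"
    by simp
  ultimately show ?case
    by (simp only:)
qed (use assms in simp)

text \<open>
  Two points of the same piece differ by an element of the \<open>\<epsilon>\<close>-ball of the injective norm, so the
  points of a packing lie in different pieces.
\<close>

lemma entropy_number_le_of_row_covered:
  fixes n m :: nat
  defines "X \<equiv> projective_tensor (linf_space n) (l2_space m)"
    and "Y \<equiv> injective_tensor (linf_space n) (l2_space m)"
  assumes "0 < n" "0 < \<epsilon>" "N \<le> 2 ^ k"
    and cover: "row_covered {..<n} {..<m} (entries ` unit_ball X) \<epsilon> N"
  shows "entropy_number X Y id (Suc k) \<le> ennreal \<epsilon>"
proof -
  obtain P where P: "finite P" "card P \<le> N" "entries ` unit_ball X \<subseteq> \<Union>P"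
    and diam: "\<forall>p\<in>P. \<forall>S\<in>p. \<forall>T\<in>p. \<forall>i\<in>{..<n}. L2_set (\<lambda>j. S i j - T i j) {..<m} \<le> \<epsilon>"
    using cover unfolding row_covered_def by blast
  have card: "l \<le> 2 ^ k" if y: "\<forall>j<l. y j \<in> unit_ball X"
    and sep: "\<forall>j<l. \<forall>k<l. j \<noteq> k \<longrightarrow> y j - y k \<notin> (\<lambda>y. \<epsilon> *\<^sub>R y) ` unit_ball Y" for l :: nat and y
  proof -
    have "\<forall>j\<in>{..<l}. \<exists>p. p \<in> P \<and> entries (y j) \<in> p"
      using y P(3) by blast
    from bchoice[OF this] obtain c where c: "\<And>j. j < l \<Longrightarrow> c j \<in> P \<and> entries (y j) \<in> c j"
      by auto
    have "inj_on c {..<l}"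
    proof (rule inj_onI, rule ccontr)
      fix i j assume ij: "i \<in> {..<l}" "j \<in> {..<l}" "c i = c j" "i \<noteq> j"
      then have "y i \<in> unit_ball X" "y j \<in> unit_ball X"
        using y by auto
      then have "y i - y j \<in> tensor_pts (linf_space n) (l2_space m)"
        by (auto simp: X_def unit_ball_def projective_tensor_def tensor_pts_def intro: span_diff)
      moreover have "L2_set (entries (y i - y j) r) {..<m} \<le> \<epsilon>" if "r < n" for r
      proof -
        have "L2_set (\<lambda>j'. entries (y i) r j' - entries (y j) r j') {..<m} \<le> \<epsilon>"
          using diam c[of i] c[of j] ij that by auto
        then show ?thesis
          by (simp add: L2_set_def)
      qed
      ultimately have "y i - y j \<in> (\<lambda>y. \<epsilon> *\<^sub>R y) ` unit_ball Y"
        unfolding Y_def using \<open>0 < n\<close> \<open>0 < \<epsilon>\<close> by (intro scaled_injective_ballI) auto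
      with sep ij show False
        by auto
    qed
    then have "card {..<l} \<le> card P"
      using c P(1) by (intro card_inj_on_le[of c]) auto
    with P(2) \<open>N \<le> 2 ^ k\<close> show ?thesis
      by simp
  qed
  have "packing_number (id ` unit_ball X) ((\<lambda>y. \<epsilon> *\<^sub>R y) ` unit_ball Y) \<le> enat (2 ^ (Suc k - 1))"
    unfolding packing_number_def
  proof (rule Sup_least)
    fix e assume "e \<in> {enat l | l. \<exists>y. (\<forall>j<l. y j \<in> id ` unit_ball X) \<and>
      (\<forall>j<l. \<forall>k<l. j \<noteq> k \<longrightarrow> y j - y k \<notin> (\<lambda>y. \<epsilon> *\<^sub>R y) ` unit_ball Y)}"
    then obtain l y where e: "e = enat l" and y: "\<forall>j<l. y j \<in> unit_ball X"
      "\<forall>j<l. \<forall>k<l. j \<noteq> k \<longrightarrow> y j - y k \<notin> (\<lambda>y. \<epsilon> *\<^sub>R y) ` unit_ball Y"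
      unfolding image_id id_apply by blast
    from card[OF y] show "e \<le> enat (2 ^ (Suc k - 1))"
      unfolding e by simp
  qed
  then show ?thesis
    unfolding entropy_number_def using \<open>0 < \<epsilon>\<close> by (intro Inf_lower) blast
qed

section \<open>Summing the entropy numbers in blocks\<close>

lemma sum_inverse_sqrt_le: "(\<Sum>k<N. 1 / sqrt (real (Suc k))) \<le> 2 * sqrt (real N)"
proof (induction N)
  case (Suc N)
  define a where "a = sqrt (real N)"
  define b where "b = sqrt (real (Suc N))"
  have "a \<le> b" "0 < b" "b * b - a * a = 1"
    by (simp_all add: a_def b_def)
  then have "1 \<le> (2 * b - 2 * a) * b"
    using mult_nonneg_nonneg[of "b - a" "b - a"] by (simp add: algebra_simps)
  then have "1 / b \<le> 2 * b - 2 * a"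
    using \<open>0 < b\<close> by (simp add: divide_le_eq)
  with Suc.IH show ?case
    by (simp add: a_def b_def)
qed simp

lemma weighted_block_le:
  assumes "0 < A" "0 \<le> c" "\<And>k. A \<le> k \<Longrightarrow> e k \<le> ennreal c"
  shows "(\<Sum>k\<in>{A..<A + B}. e k / ennreal (sqrt (real (Suc k)))) \<le> ennreal (real B * c / sqrt (real A))"
proof -
  have "(\<Sum>k\<in>{A..<A + B}. e k / ennreal (sqrt (real (Suc k)))) \<le> (\<Sum>k\<in>{A..<A + B}. ennreal (c / sqrt (real A)))"
  proof (rule sum_mono)
    fix k assume k: "k \<in> {A..<A + B}"
    have "e k / ennreal (sqrt (real (Suc k))) \<le> ennreal c / ennreal (sqrt (real (Suc k)))"
      using assms(3) k by (intro divide_right_mono_ennreal) auto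
    also have "\<dots> = ennreal (c / sqrt (real (Suc k)))"
      using \<open>0 \<le> c\<close> by (intro divide_ennreal) auto
    also have "\<dots> \<le> ennreal (c / sqrt (real A))"
      using assms k by (intro ennreal_leI divide_left_mono) auto
    finally show "e k / ennreal (sqrt (real (Suc k))) \<le> ennreal (c / sqrt (real A))" .
  qed
  also have "\<dots> = ennreal (real B * c / sqrt (real A))"
    using assms by (simp add: ennreal_of_nat_eq_real_of_nat flip: ennreal_mult')
  finally show ?thesis .
qed

lemma weighted_initial_block_le:
  assumes "0 \<le> c" "\<And>k. e k \<le> ennreal c"
  shows "(\<Sum>k<N. e k / ennreal (sqrt (real (Suc k)))) \<le> ennreal (2 * c * sqrt (real N))"
proof -
  have "(\<Sum>k<N. e k / ennreal (sqrt (real (Suc k)))) \<le> (\<Sum>k<N. ennreal (c * (1 / sqrt (real (Suc k)))))"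
  proof (rule sum_mono)
    fix k
    have "e k / ennreal (sqrt (real (Suc k))) \<le> ennreal c / ennreal (sqrt (real (Suc k)))"
      using assms(2) by (intro divide_right_mono_ennreal) auto
    also have "\<dots> = ennreal (c * (1 / sqrt (real (Suc k))))"
      using \<open>0 \<le> c\<close> by (subst divide_ennreal) auto
    finally show "e k / ennreal (sqrt (real (Suc k))) \<le> ennreal (c * (1 / sqrt (real (Suc k))))" .
  qed
  also have "\<dots> = ennreal (c * (\<Sum>k<N. 1 / sqrt (real (Suc k))))"
    using \<open>0 \<le> c\<close> by (subst sum_ennreal) (auto simp: sum_distrib_left)
  also have "\<dots> \<le> ennreal (2 * c * sqrt (real N))"
    using mult_left_mono[OF sum_inverse_sqrt_le \<open>0 \<le> c\<close>] by (intro ennreal_leI) (simp add: mult_ac)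
  finally show ?thesis .
qed

text \<open>
  The sum over \<open>k\<close> is cut into blocks of length \<open>D\<close> up to \<open>n * D\<close>, and into blocks of length \<open>n * D\<close>
  from there on. The first block is bounded by \<open>start\<close>. The block beginning at \<open>N * D\<close> contributes
  \<open>sqrt D * c / N\<close>, which gives the harmonic number, and the long blocks form a geometric series.
\<close>

lemma weighted_sum_le:
  fixes e :: "nat \<Rightarrow> ennreal"
  assumes "0 < D" "0 < n" "0 \<le> c"
    and start: "\<And>k. e k \<le> ennreal 2"
    and decay: "\<And>N k. 0 < N \<Longrightarrow> N * D \<le> k \<Longrightarrow> e k \<le> ennreal (c / sqrt (real N))"
    and tail: "\<And>j k. Suc j * (n * D) \<le> k \<Longrightarrow> e k \<le> ennreal (c / sqrt (real n) / 2 ^ j)"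
  shows "suminf (\<lambda>k. e k / ennreal (sqrt (real (Suc k)))) \<le> ennreal (sqrt (real D) * (4 + c * harm n + 2 * c))"
proof (rule suminf_le_const[OF summableI])
  fix p
  define a where "a = (\<lambda>k. e k / ennreal (sqrt (real (Suc k))))"
  obtain n' where n: "n = Suc n'"
    using \<open>0 < n\<close> by (cases n) auto
  have "sum a {..<n * D} = (\<Sum>N<n. sum a {N * D..<N * D + D})"
    by (rule sum.nat_group[symmetric])
  also have "\<dots> = sum a {..<D} + (\<Sum>N<n'. sum a {Suc N * D..<Suc N * D + D})"
    unfolding n by (subst sum.lessThan_Suc_shift) (simp add: atLeast0LessThan)
  also have "\<dots> \<le> ennreal (2 * 2 * sqrt (real D)) + (\<Sum>N<n'. ennreal (sqrt (real D) * c * inverse (real (Suc N))))"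
  proof (intro add_mono sum_mono)
    show "sum a {..<D} \<le> ennreal (2 * 2 * sqrt (real D))"
      unfolding a_def using start by (intro weighted_initial_block_le) auto
    fix N
    have "sum a {Suc N * D..<Suc N * D + D} \<le> ennreal (real D * (c / sqrt (real (Suc N))) / sqrt (real (Suc N * D)))"
      unfolding a_def using assms(1-3) by (intro weighted_block_le decay) auto
    also have "real D * (c / sqrt (real (Suc N))) / sqrt (real (Suc N * D)) =
        (real D / sqrt (real D)) * c / (sqrt (real (Suc N)) * sqrt (real (Suc N)))"
      by (simp only: of_nat_mult real_sqrt_mult times_divide_eq_right times_divide_eq_left divide_divide_eq_left mult_ac)
    also have "\<dots> = sqrt (real D) * c * inverse (real (Suc N))"
      unfolding real_div_sqrt[OF of_nat_0_le_iff] real_sqrt_mult_self abs_of_nat by (rule divide_inverse)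
    finally show "sum a {Suc N * D..<Suc N * D + D} \<le> ennreal (sqrt (real D) * c * inverse (real (Suc N)))" .
  qed
  also have "\<dots> = ennreal (sqrt (real D) * 4 + sqrt (real D) * c * (\<Sum>N<n'. inverse (real (Suc N))))"
    using \<open>0 \<le> c\<close>
    by (subst sum_ennreal) (auto simp: sum_distrib_left mult.commute sum_nonneg simp flip: ennreal_plus)
  also have "\<dots> \<le> ennreal (sqrt (real D) * 4 + sqrt (real D) * c * harm n)"
  proof -
    have "(\<Sum>N<n'. inverse (real (Suc N))) = harm n'"
      unfolding harm_def by (rule sum.reindex_bij_witness[of _ "\<lambda>k. k - 1" Suc]) auto
    also have "\<dots> \<le> harm n"
      unfolding n by (simp add: harm_Suc)
    finally show ?thesis
      using \<open>0 \<le> c\<close> by (intro ennreal_leI add_left_mono mult_left_mono) auto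
  qed
  finally have head: "sum a {..<n * D} \<le> ennreal (sqrt (real D) * 4 + sqrt (real D) * c * harm n)" .
  have "(\<Sum>j<p. sum a {Suc j * (n * D)..<Suc j * (n * D) + n * D}) \<le> (\<Sum>j<p. ennreal (sqrt (real D) * c * (1 / 2) ^ j))"
  proof (rule sum_mono)
    fix j
    have "sum a {Suc j * (n * D)..<Suc j * (n * D) + n * D} \<le>
        ennreal (real (n * D) * (c / sqrt (real n) / 2 ^ j) / sqrt (real (Suc j * (n * D))))"
      unfolding a_def using assms(1-3) by (intro weighted_block_le tail) auto
    also have "\<dots> \<le> ennreal (real (n * D) * (c / sqrt (real n) / 2 ^ j) / sqrt (real (n * D)))"
    proof (intro ennreal_leI divide_left_mono)
      show "sqrt (real (n * D)) \<le> sqrt (real (Suc j * (n * D)))"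
        by simp
      show "0 \<le> real (n * D) * (c / sqrt (real n) / 2 ^ j)"
        using \<open>0 \<le> c\<close> by simp
      show "0 < sqrt (real (Suc j * (n * D))) * sqrt (real (n * D))"
        using assms(1,2) by (intro mult_pos_pos) (auto simp only: real_sqrt_gt_0_iff of_nat_0_less_iff nat_0_less_mult_iff zero_less_Suc)
    qed
    also have "real (n * D) * (c / sqrt (real n) / 2 ^ j) / sqrt (real (n * D)) =
        (real (n * D) / sqrt (real (n * D))) * (c / sqrt (real n) / 2 ^ j)"
      by simp
    also have "real (n * D) / sqrt (real (n * D)) = sqrt (real n) * sqrt (real D)"
      unfolding real_div_sqrt[OF of_nat_0_le_iff] by (simp add: real_sqrt_mult)
    also have "sqrt (real n) * sqrt (real D) * (c / sqrt (real n) / 2 ^ j) = sqrt (real D) * c * (1 / 2) ^ j"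
      using \<open>0 < n\<close> by (simp add: power_divide)
    finally show "sum a {Suc j * (n * D)..<Suc j * (n * D) + n * D} \<le> ennreal (sqrt (real D) * c * (1 / 2) ^ j)" .
  qed
  also have "\<dots> = ennreal (sqrt (real D) * c * (\<Sum>j<p. (1 / 2) ^ j))"
    using \<open>0 \<le> c\<close> by (subst sum_ennreal) (auto simp: sum_distrib_left)
  also have "\<dots> \<le> ennreal (sqrt (real D) * c * 2)"
  proof -
    have "(\<Sum>j<p. (1 / 2 :: real) ^ j) \<le> 2"
      by (simp add: geometric_sum)
    then show ?thesis
      using \<open>0 \<le> c\<close> by (intro ennreal_leI mult_left_mono) auto
  qed
  finally have rest: "(\<Sum>j<p. sum a {Suc j * (n * D)..<Suc j * (n * D) + n * D}) \<le> ennreal (sqrt (real D) * c * 2)" .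
  \<comment> \<open>complete the partial sum to a whole number of long blocks\<close>
  have "sum a {..<p} \<le> sum a {..<Suc p * (n * D)}"
  proof (rule sum_mono2)
    have "p * 1 \<le> Suc p * (n * D)"
      using assms(1,2) by (intro mult_le_mono) auto
    then show "{..<p} \<subseteq> {..<Suc p * (n * D)}"
      by auto
  qed auto
  also have "\<dots> = (\<Sum>j<Suc p. sum a {j * (n * D)..<j * (n * D) + n * D})"
    by (rule sum.nat_group[symmetric])
  also have "\<dots> = sum a {..<n * D} + (\<Sum>j<p. sum a {Suc j * (n * D)..<Suc j * (n * D) + n * D})"
    by (subst sum.lessThan_Suc_shift) (simp add: atLeast0LessThan)
  also have "\<dots> \<le> ennreal (sqrt (real D) * 4 + sqrt (real D) * c * harm n) + ennreal (sqrt (real D) * c * 2)"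
    by (intro add_mono head rest)
  also have "\<dots> = ennreal (sqrt (real D) * (4 + c * harm n + 2 * c))"
    using \<open>0 \<le> c\<close> harm_nonneg[of n, where ?'a = real]
    by (subst ennreal_plus[symmetric]) (auto simp: algebra_simps intro!: mult_nonneg_nonneg add_nonneg_nonneg)
  finally show "(\<Sum>k<p. e k / ennreal (sqrt (real (Suc k)))) \<le> ennreal (sqrt (real D) * (4 + c * harm n + 2 * c))"
    unfolding a_def .
qed

section \<open>Entropy numbers of the identity\<close>

text \<open>
  Atoms have rows of norm at most \<open>2\<close> and points of \<open>K\<close> have rows of norm at most \<open>1\<close>, so the
  increments in the empirical method have norm at most \<open>3\<close>.
\<close>

lemma projective_ball_row_covered:
  fixes n m N :: nat
  defines "K \<equiv> entries ` unit_ball (projective_tensor (linf_space n) (l2_space m))"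
  assumes "0 < n" "0 < m" "0 < N"
  shows "row_covered {..<n} {..<m} K (9 * sqrt (1 + ln (real n)) / sqrt (real N)) (2 ^ (5 * (n + m) * N))"
proof -
  define \<epsilon> where "\<epsilon> = 2 * 3 * sqrt (2 * ln (2 * real (card {..<n})) / real N)"
  have cov: "row_covered {..<n} {..<m} K \<epsilon> (card (atoms {..<n} {..<m}) ^ N)"
    unfolding \<epsilon>_def
  proof (rule row_covered_empirical)
    fix T assume T: "T \<in> K"
    then obtain U where U: "U \<in> unit_ball (projective_tensor (linf_space n) (l2_space m))" "T = entries U"
      by (auto simp: K_def)
    show "\<exists>z\<in>atoms {..<n} {..<m}. (\<Sum>i<n. \<Sum>j<m. A i j * z i j) \<le> (\<Sum>i<n. \<Sum>j<m. A i j * T i j)" for A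
      unfolding U(2) by (rule projective_ball_atoms[OF U(1) assms(2,3)])
    fix z i assume z: "z \<in> atoms {..<n} {..<m}" "i \<in> {..<n}"
    have "L2_set (\<lambda>j. z i j - T i j) {..<m} \<le> L2_set (z i) {..<m} + L2_set (\<lambda>j. - T i j) {..<m}"
      using L2_set_triangle_ineq[of "z i" "\<lambda>j. - T i j" "{..<m}"] by simp
    also have "L2_set (\<lambda>j. - T i j) {..<m} = L2_set (T i) {..<m}"
      by (simp add: L2_set_def)
    finally show "L2_set (\<lambda>j. z i j - T i j) {..<m} \<le> 3"
      using atoms_row_le[OF _ z] projective_ball_row_le[OF U(1), of i] z(2) U(2) by simp
  qed (use assms in \<open>auto simp: card_atoms_le\<close>)
  have "card (atoms {..<n} {..<m}) \<le> 2 ^ n * 12 ^ m"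
    using card_atoms_le(2)[of "{..<n}" "{..<m}"] by simp
  also have "\<dots> \<le> 2 ^ (5 * n) * (2 ^ 5) ^ m"
    by (intro mult_mono power_increasing power_mono) auto
  also have "\<dots> = 2 ^ (5 * (n + m))"
    by (simp only: power_mult power_add distrib_left)
  finally have "card (atoms {..<n} {..<m}) ^ N \<le> (2 ^ (5 * (n + m))) ^ N"
    by (rule power_mono) simp
  then have card: "card (atoms {..<n} {..<m}) ^ N \<le> 2 ^ (5 * (n + m) * N)"
    by (simp only: power_mult)
  have "\<epsilon> = 6 * sqrt 2 * (sqrt (ln (2 * real n)) / sqrt (real N))"
    by (simp add: \<epsilon>_def real_sqrt_mult real_sqrt_divide)
  also have "\<dots> \<le> 9 * (sqrt (1 + ln (real n)) / sqrt (real N))"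
  proof (intro mult_mono divide_right_mono)
    have "sqrt 2 \<le> 3 / 2"
      by (rule real_le_lsqrt) (auto simp: power2_eq_square)
    then show "6 * sqrt 2 \<le> 9"
      by simp
    have "ln (2 * real n) \<le> 1 + ln (real n)"
      using \<open>0 < n\<close> ln_2_less_1 by (simp add: ln_mult)
    then show "sqrt (ln (2 * real n)) \<le> sqrt (1 + ln (real n))"
      by simp
  qed (use \<open>0 < n\<close> in auto)
  finally have "\<epsilon> \<le> 9 * sqrt (1 + ln (real n)) / sqrt (real N)"
    by simp
  with cov card show ?thesis
    by (rule row_covered_mono)
qed

text \<open>
  The blocks have length \<open>D = 5 * (n + m)\<close>, because \<open>2 ^ D\<close> bounds the number of atoms. A halving of
  the diameter multiplies the number of pieces by \<open>24 ^ (n * m)\<close>, and \<open>2 ^ (n * D)\<close> bounds this factor.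
\<close>

lemma entropy_sum_le:
  assumes "0 < n" "0 < m"
  shows "entropy_sum_2_1 (projective_tensor (linf_space n) (l2_space m))
      (injective_tensor (linf_space n) (l2_space m)) id
    \<le> ennreal (sqrt (real (5 * (n + m))) * (4 + 9 * sqrt (1 + ln (real n)) * harm n + 2 * (9 * sqrt (1 + ln (real n)))))"
  unfolding entropy_sum_2_1_def
proof (rule weighted_sum_le)
  define K where "K = entries ` unit_ball (projective_tensor (linf_space n) (l2_space m))"
  define c where "c = 9 * sqrt (1 + ln (real n))"
  define e where "e = (\<lambda>k. entropy_number (projective_tensor (linf_space n) (l2_space m))
      (injective_tensor (linf_space n) (l2_space m)) id (Suc k))"
  have c: "0 < c"
  proof -
    have "0 \<le> ln (real n)"
      using \<open>0 < n\<close> by simp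
    then show ?thesis
      by (simp add: c_def)
  qed
  have cover: "row_covered {..<n} {..<m} K (c / sqrt (real N)) (2 ^ (5 * (n + m) * N))" if "0 < N" for N
    unfolding K_def c_def using projective_ball_row_covered[OF assms that] .
  have e_le: "e k \<le> ennreal \<epsilon>" if "row_covered {..<n} {..<m} K \<epsilon> N" "0 < \<epsilon>" "N \<le> 2 ^ k" for k \<epsilon> N
    unfolding e_def using that \<open>0 < n\<close> by (intro entropy_number_le_of_row_covered) (auto simp: K_def)
  show "e k \<le> ennreal 2" for k
  proof (rule e_le)
    have "L2_set (\<lambda>j. S i j - T i j) {..<m} \<le> 2" if ST: "S \<in> K" "T \<in> K" and i: "i < n" for S T i
    proof -
      have "L2_set (\<lambda>j. S i j + - T i j) {..<m} \<le> L2_set (S i) {..<m} + L2_set (\<lambda>j. - T i j) {..<m}"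
        by (rule L2_set_triangle_ineq)
      also have "L2_set (\<lambda>j. - T i j) {..<m} = L2_set (T i) {..<m}"
        by (simp add: L2_set_def)
      also have "L2_set (S i) {..<m} + L2_set (T i) {..<m} \<le> 1 + 1"
        using ST by (intro add_mono) (auto simp: K_def intro: projective_ball_row_le i)
      finally show ?thesis
        by simp
    qed
    then show "row_covered {..<n} {..<m} K 2 1"
      unfolding row_covered_def by (intro exI[of _ "{K}"]) auto
  qed auto
  show "e k \<le> ennreal (c / sqrt (real N))" if "0 < N" "N * (5 * (n + m)) \<le> k" for N k
    using that c by (intro e_le[OF cover] power_increasing) (auto simp: mult_ac)
  show "e k \<le> ennreal (c / sqrt (real n) / 2 ^ j)" if k: "Suc j * (n * (5 * (n + m))) \<le> k" for j k
  proof (rule e_le)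
    show "row_covered {..<n} {..<m} K (c / sqrt (real n) / 2 ^ j)
        (2 ^ (5 * (n + m) * n) * 24 ^ (card {..<n} * card {..<m} * j))"
      using assms c by (intro row_covered_halvings cover) auto
    show "0 < c / sqrt (real n) / 2 ^ j"
      using c \<open>0 < n\<close> by simp
    have "(24 :: nat) ^ (card {..<n} * card {..<m} * j) \<le> (2 ^ 5) ^ (n * m * j)"
      by (simp add: power_mono)
    also have "\<dots> = 2 ^ (5 * (n * m * j))"
      by (simp only: power_mult)
    also have "\<dots> \<le> 2 ^ (5 * (n * (n + m) * j))"
      by (intro power_increasing mult_le_mono) auto
    finally have "2 ^ (5 * (n + m) * n) * 24 ^ (card {..<n} * card {..<m} * j)
        \<le> (2 :: nat) ^ (5 * (n + m) * n) * 2 ^ (5 * (n * (n + m) * j))"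
      by simp
    also have "\<dots> = 2 ^ (Suc j * (n * (5 * (n + m))))"
      by (simp add: algebra_simps flip: power_add)
    also have "\<dots> \<le> 2 ^ k"
      using k by (intro power_increasing) auto
    finally show "2 ^ (5 * (n + m) * n) * 24 ^ (card {..<n} * card {..<m} * j) \<le> (2 :: nat) ^ k" .
  qed
qed (use assms in auto)

theorem proposition5p4:
  shows "\<exists>C::real. C > 0 \<and> (\<forall>m n::nat. m \<ge> 1 \<longrightarrow> n \<ge> 1 \<longrightarrow>
    entropy_sum_2_1
      (projective_tensor (linf_space n) (l2_space m))
      (injective_tensor (linf_space n) (l2_space m)) id
    \<le> ennreal (C * sqrt (1 + real n + real m) * (1 + ln (real n)) powr (3 / 2)))"
\<comment> \<open>\<open>31 = 4 + 9 + 18\<close> collects the three ranges of \<open>k\<close>, and \<open>5\<close> comes from the block length\<close>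
proof (intro exI[of _ "31 * sqrt 5"] conjI allI impI)
  fix m n :: nat
  assume mn: "m \<ge> 1" "n \<ge> 1"
  define L where "L = 1 + ln (real n)"
  have L: "1 \<le> L"
    using mn by (simp add: L_def)
  have "harm n - ln (of_nat n) \<le> harm 1 - ln (of_nat 1 :: real)"
    using mn by (intro euler_mascheroni_sequence_decreasing) auto
  then have harm: "harm n \<le> L"
    by (simp add: L_def harm_def)
  have sqrtL: "1 \<le> sqrt L"
    using L by simp
  have "4 + 9 * sqrt L * harm n + 2 * (9 * sqrt L) \<le> 4 * (L * sqrt L) + 9 * (L * sqrt L) + 18 * (L * sqrt L)"
  proof (intro add_mono)
    show "4 \<le> 4 * (L * sqrt L)"
      using mult_mono[OF L sqrtL] L by simp
    show "9 * sqrt L * harm n \<le> 9 * (L * sqrt L)"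
      using mult_right_mono[OF harm, of "sqrt L"] L by (simp add: mult_ac)
    show "2 * (9 * sqrt L) \<le> 18 * (L * sqrt L)"
      using mult_right_mono[OF L, of "sqrt L"] L by simp
  qed
  also have "\<dots> = 31 * (L * sqrt L)"
    by simp
  also have "L * sqrt L = L powr (3 / 2)"
    using L powr_add[of L 1 "1 / 2"] by (simp add: powr_half_sqrt)
  finally have factor: "4 + 9 * sqrt L * harm n + 2 * (9 * sqrt L) \<le> 31 * L powr (3 / 2)" .
  have "entropy_sum_2_1 (projective_tensor (linf_space n) (l2_space m)) (injective_tensor (linf_space n) (l2_space m)) id
      \<le> ennreal (sqrt (real (5 * (n + m))) * (4 + 9 * sqrt L * harm n + 2 * (9 * sqrt L)))"
    unfolding L_def using mn by (intro entropy_sum_le) auto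
  also have "\<dots> \<le> ennreal ((sqrt 5 * sqrt (1 + real n + real m)) * (31 * L powr (3 / 2)))"
  proof (intro ennreal_leI mult_mono factor)
    show "sqrt (real (5 * (n + m))) \<le> sqrt 5 * sqrt (1 + real n + real m)"
      by (simp flip: real_sqrt_mult)
    show "0 \<le> 4 + 9 * sqrt L * harm n + 2 * (9 * sqrt L)"
      using L harm_nonneg[of n, where ?'a = real] by simp
  qed simp
  finally show "entropy_sum_2_1 (projective_tensor (linf_space n) (l2_space m)) (injective_tensor (linf_space n) (l2_space m)) id
      \<le> ennreal (31 * sqrt 5 * sqrt (1 + real n + real m) * (1 + ln (real n)) powr (3 / 2))"
    by (simp add: L_def mult_ac)
qed simp

end
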